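(* In the setting described in the context (all of assumptions A1–A4 in force), let $\epsilon\in(0,\epsilon_0]$, and for $n\ge0$ let $$\beta_n:=\max_{0\le k\le n-1}\Big[e^{-\lambda\sum_{i=k+1}^{n-1}a_i}\Big]a_k .$$ Then there exist constants $C_1,C_2>0$ and functions $g_1(\epsilon)=O(\log[1/\epsilon])$, $g_2(\epsilon)=O(1/\epsilon)$, where $C_1,C_2$ and the hidden constants in $g_1,g_2$ depend only on $\lambda,d,r$ and $u_L$, such that: if $T\ge g_1(\epsilon)$, $1/a_n\ge g_2(\epsilon)$ for all $n\ge0$, and $\bar x(0)=x_0$ lies in $B$, then $$\Pr\{\|\bar x(t)-x^*\|\le\epsilon\ \ \forall t\ge T+1\}\ \ge\ 1-\sum_{n=0}^\infty C_1\exp\Big(-\frac{C_2\sqrt\epsilon}{\sqrt{a_n}}\Big)-\sum_{n=0}^\infty C_1\exp\Big(-\frac{C_2\min\{\epsilon,\epsilon^2\}}{\beta_n}\Big).$$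
   Context: $\|\cdot\|$ is the Euclidean norm for vectors and the corresponding operator (spectral) norm for matrices. The $\mathbb{R}^d$-valued iterates are $$x_{n+1}=x_n+a_n[h(x_n)+M_{n+1}],\quad n\ge0,$$ with step sizes $\{a_n\}$, a deterministic map $h:\mathbb{R}^d\to\mathbb{R}^d$, and noise $\{M_n\}$. The limiting ODE is $\dot x(t)=h(x(t))$. The point $x^*$ is a locally asymptotically stable equilibrium of this ODE: it is an equilibrium, for every $\eta>0$ there is $\delta>0$ such that trajectories started within $\delta$ of $x^*$ stay within $\eta$ of it, and there is an open neighbourhood of $x^*$ (the domain of attraction) such that every trajectory started there converges to $x^*$. The Jacobian $Dh(x^* )$ is Hurwitz. $B$ is a bounded set containing $x^*$ and contained in the domain of attraction of $x^*$. Interpolation: $t_0=0$, $t_{n+1}=t_n+a_n$, $\bar x(t_n)=x_n$, and $\bar x(t)=\bar x(t_n)+\frac{t-t_n}{a_n}[\bar x(t_{n+1})-\bar x(t_n)]$ for $t\in(t_n,t_{n+1})$. Assumptions: A1. $h$ is twice continuously differentiable. A2. $a_n>0$, $\sum_n a_n=\infty$, $\lim_n a_n=0$, $\sup_n a_n\le 1$. A3. $\{M_n\}$ is an $\mathbb{R}^d$-valued martingale-difference sequence with respect to $\mathcal F_n:=\sigma(x_0,M_1,\dots,M_n)$, i.e. $\mathbb E[M_{n+1}|\mathcal F_n]=0$ a.s., and there are continuous functions $c_1,c_2:\mathbb{R}^d\to(0,\infty)$ such that $\Pr\{\|M_{n+1}\|>u\,|\,\mathcal F_n\}\le c_1(x_n)e^{-c_2(x_n)u}$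 for all $n\ge0$ and all $u\ge u_L$, where $u_L$ is some sufficiently large but fixed number. A4. There exist $r,r_0,\epsilon_0>0$ with $r>r_0$ such that for $0<\epsilon\le\epsilon_0$, $$\{x:\|x-x^*\|\le\epsilon\}\subseteq B\subseteq V^{r_0}\subset\mathcal N_{\epsilon_0}(V^{r_0})\subseteq V^r\subset \mathrm{dom}(V),$$ where $V$ is a Liapunov function near $x^*$, i.e. $V:\mathrm{dom}(V)\subseteq\mathbb{R}^d\to\mathbb{R}$ is continuously differentiable, $V(x^* )=0$, and $V(x)>0$, $\nabla V(x)\cdot h(x)<0$ for $x\ne x^*$; $V^{q}:=\{x\in\mathrm{dom}(V):V(x)\le q\}$; $\mathcal N_{\epsilon_0}(V^{r_0}):=\{x:\exists y\in V^{r_0},\ \|x-y\|\le\epsilon_0\}$. The set $V^r$ is compact. The rate $\lambda$: let $\lambda_{\min}(x^* ):=\min_i\{-\mathrm{real}(\lambda_i(x^* ))\}>0$, where $\lambda_i(x^* )$ are the eigenvalues of $Dh(x^* )$. Fix $0<\lambda'<\lambda_{\min}(x^* )$, $0<\kappa<1$, and $\tilde K\ge1$ with $\|e^{Dh(x^* )t}\|\le\tilde Ke^{-\lambda' t}$ for all $t\ge0$; then $\lambda:=\frac{1-\kappa}{\tilde K^2}\lambda'$. The $O(\cdot)$ for $g_1,g_2$ are as $\epsilon\to0$. For $n=0$ the maximum defining $\beta_0$ is over the empty set; it is read as $0$ and the corresponding exponential term as $0$.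
   Formalization: C_1, C_2, g_1, g_2 may also depend on the fixed data h, x*, V, c_1, c_2 (independence of these is false: c_1, c_2 can allow arbitrarily large noise); they are uniform over r_0, ε_0, B, ε, T, the step sizes and the noise on a given sample space. *)

theory Defs
  imports "HOL-Probability.Probability"
begin

definition twice_cont_differentiable ::
  "('a::real_normed_vector \<Rightarrow> 'b::real_normed_vector) \<Rightarrow> bool" where
  "twice_cont_differentiable h \<longleftrightarrow>
     (\<exists>(Dh :: 'a \<Rightarrow> 'a \<Rightarrow>\<^sub>L 'b) (D2h :: 'a \<Rightarrow> 'a \<Rightarrow>\<^sub>L 'a \<Rightarrow>\<^sub>L 'b).
        (\<forall>x. (h has_derivative blinfun_apply (Dh x)) (at x)) \<and>
        (\<forall>x. (Dh has_derivative blinfun_apply (D2h x)) (at x)) \<and>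
        continuous_on UNIV D2h)"

definition trajectory :: "('a::real_normed_vector \<Rightarrow> 'a) \<Rightarrow> (real \<Rightarrow> 'a) \<Rightarrow> bool" where
  "trajectory h \<phi> \<longleftrightarrow>
     (\<forall>t\<ge>0. (\<phi> has_vector_derivative h (\<phi> t)) (at t within {0..}))"

text \<open>
  Trajectories are solutions on the whole half line. Convergence of every trajectory started in
  the domain presupposes that it is defined for all times, hence the first conjunct below:
  a starting point whose solution blows up is not attracted.
\<close>

definition attraction_domain ::
  "('a::real_normed_vector \<Rightarrow> 'a) \<Rightarrow> 'a \<Rightarrow> 'a set \<Rightarrow> bool" where
  "attraction_domain h xs A \<longleftrightarrow> open A \<and> xs \<in> A \<and>
     (\<forall>x\<in>A. (\<exists>\<phi>. trajectory h \<phi> \<and> \<phi> 0 = x) \<and>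
            (\<forall>\<phi>. trajectory h \<phi> \<and> \<phi> 0 = x \<longrightarrow> (\<phi> \<longlongrightarrow> xs) at_top))"

definition locally_asymptotically_stable ::
  "('a::real_normed_vector \<Rightarrow> 'a) \<Rightarrow> 'a \<Rightarrow> bool" where
  "locally_asymptotically_stable h xs \<longleftrightarrow>
     h xs = 0 \<and>
     (\<forall>\<eta>>0. \<exists>\<delta>>0. \<forall>\<phi>. trajectory h \<phi> \<and> norm (\<phi> 0 - xs) < \<delta> \<longrightarrow>
        (\<forall>t\<ge>0. norm (\<phi> t - xs) < \<eta>)) \<and>
     (\<exists>A. attraction_domain h xs A)"

definition complex_eigenvalues :: "real^'n^'n \<Rightarrow> complex set" where
  "complex_eigenvalues A =
     {\<mu>. \<exists>v :: complex^'n. v \<noteq> 0 \<and> map_matrix complex_of_real A *v v = \<mu> *s v}"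

definition hurwitz :: "real^'n^'n \<Rightarrow> bool" where
  "hurwitz A \<longleftrightarrow> (\<forall>\<mu>\<in>complex_eigenvalues A. Re \<mu> < 0)"

definition lambda_min :: "real^'n^'n \<Rightarrow> real" where
  "lambda_min A = Min ((\<lambda>\<mu>. - Re \<mu>) ` complex_eigenvalues A)"

text \<open>
  The library provides no Banach algebra structure on \<open>real^'n^'n\<close>, so \<open>exp\<close> does not apply to
  matrices; the exponential series is written out.
\<close>

definition matrix_exp :: "real^'n^'n \<Rightarrow> real^'n^'n" where
  "matrix_exp A = (\<Sum>k. (1 / fact k) *\<^sub>R ((\<lambda>X. A ** X) ^^ k) (mat 1))"

definition spectral_norm :: "real^'n^'n \<Rightarrow> real" where
  "spectral_norm A = onorm (\<lambda>v. A *v v)"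

text \<open>
  \<open>lam\<close> is one of the rates
  \<open>(1 - \<kappa>) / K\<^sup>2 * lam'\<close> that arise from an admissible choice of \<open>lam'\<close>, \<open>\<kappa>\<close>, \<open>K\<close>.
\<close>

definition admissible_rate :: "real^'n^'n \<Rightarrow> real \<Rightarrow> bool" where
  "admissible_rate A lam \<longleftrightarrow>
     (\<exists>lam' \<kappa> K. 0 < lam' \<and> lam' < lambda_min A \<and> 0 < \<kappa> \<and> \<kappa> < 1 \<and> 1 \<le> K \<and>
        (\<forall>t\<ge>0. spectral_norm (matrix_exp (t *\<^sub>R A)) \<le> K * exp (- lam' * t)) \<and>
        lam = (1 - \<kappa>) / K\<^sup>2 * lam')"

text \<open>
  A Liapunov function is a total function that is only constrained on its domain \<open>D\<close>, which is
  open so that continuous differentiability makes sense.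
\<close>

definition liapunov_function ::
  "('a::real_inner \<Rightarrow> 'a) \<Rightarrow> 'a \<Rightarrow> 'a set \<Rightarrow> ('a \<Rightarrow> real) \<Rightarrow> bool" where
  "liapunov_function h xs D V \<longleftrightarrow> open D \<and> xs \<in> D \<and> V xs = 0 \<and>
     (\<exists>gV. continuous_on D gV \<and> (\<forall>x\<in>D. GDERIV V x :> gV x) \<and>
        (\<forall>x\<in>D - {xs}. 0 < V x \<and> gV x \<bullet> h x < 0))"

definition sublevel :: "'a set \<Rightarrow> ('a \<Rightarrow> real) \<Rightarrow> real \<Rightarrow> 'a set" where
  "sublevel D V q = {x \<in> D. V x \<le> q}"

definition nbhd :: "real \<Rightarrow> 'a::real_normed_vector set \<Rightarrow> 'a set" where
  "nbhd e S = {x. \<exists>y\<in>S. norm (x - y) \<le> e}"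

definition step_sizes :: "(nat \<Rightarrow> real) \<Rightarrow> bool" where
  "step_sizes a \<longleftrightarrow> (\<forall>n. 0 < a n) \<and>
     filterlim (\<lambda>n. \<Sum>k<n. a k) at_top sequentially \<and>
     a \<longlonglongrightarrow> 0 \<and> (\<forall>n. a n \<le> 1)"

text \<open>The noise variables are \<open>M 1, M 2, \<dots>\<close>; \<open>M 0\<close> is not used.\<close>

primrec iterate ::
  "('a::real_vector \<Rightarrow> 'a) \<Rightarrow> (nat \<Rightarrow> real) \<Rightarrow> ('w \<Rightarrow> 'a) \<Rightarrow> (nat \<Rightarrow> 'w \<Rightarrow> 'a) \<Rightarrow> nat \<Rightarrow> 'w \<Rightarrow> 'a"
where
  "iterate h a x0 M 0 \<omega> = x0 \<omega>"
| "iterate h a x0 M (Suc n) \<omega> =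
     iterate h a x0 M n \<omega> + a n *\<^sub>R (h (iterate h a x0 M n \<omega>) + M (Suc n) \<omega>)"

definition time_grid :: "(nat \<Rightarrow> real) \<Rightarrow> nat \<Rightarrow> real" where
  "time_grid a n = (\<Sum>k<n. a k)"

text \<open>
  For \<open>t \<ge> 0\<close> the index \<open>n\<close> below is the one with
  \<open>time_grid a n \<le> t < time_grid a (Suc n)\<close>. Negative times are not meaningful.
\<close>

definition interpolation ::
  "(nat \<Rightarrow> real) \<Rightarrow> (nat \<Rightarrow> 'a::real_vector) \<Rightarrow> real \<Rightarrow> 'a" where
  "interpolation a x t =
     (let n = (LEAST n. t < time_grid a (Suc n))
      in x n + ((t - time_grid a n) / a n) *\<^sub>R (x (Suc n) - x n))"

definition noise_filtration ::
  "'w measure \<Rightarrow> ('w \<Rightarrow> 'a::topological_space) \<Rightarrow> (nat \<Rightarrow> 'w \<Rightarrow> 'a) \<Rightarrow> nat \<Rightarrow> 'w measure" where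
  "noise_filtration P x0 M n =
     sigma (space P)
       ({x0 -` S \<inter> space P | S. S \<in> sets borel} \<union>
        {M k -` S \<inter> space P | k S. 1 \<le> k \<and> k \<le> n \<and> S \<in> sets borel})"

text \<open>
  The library's conditional expectation is real-valued; that of a vector is taken componentwise.
\<close>

definition martingale_difference ::
  "'w measure \<Rightarrow> ('w \<Rightarrow> real^'n) \<Rightarrow> (nat \<Rightarrow> 'w \<Rightarrow> real^'n) \<Rightarrow> bool" where
  "martingale_difference P x0 M \<longleftrightarrow>
     (\<forall>n. integrable P (M (Suc n)) \<and>
        (\<forall>i. AE \<omega> in P.
           real_cond_exp P (noise_filtration P x0 M n) (\<lambda>\<omega>. M (Suc n) \<omega> $ i) \<omega> = 0))"

definition exponential_tails ::
  "'w measure \<Rightarrow> (real^'n \<Rightarrow> real^'n) \<Rightarrow> (nat \<Rightarrow> real) \<Rightarrow> ('w \<Rightarrow> real^'n) \<Rightarrow>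
   (nat \<Rightarrow> 'w \<Rightarrow> real^'n) \<Rightarrow> (real^'n \<Rightarrow> real) \<Rightarrow> (real^'n \<Rightarrow> real) \<Rightarrow> real \<Rightarrow> bool" where
  "exponential_tails P h a x0 M c1 c2 uL \<longleftrightarrow>
     (\<forall>n. \<forall>u\<ge>uL. AE \<omega> in P.
        real_cond_exp P (noise_filtration P x0 M n)
          (indicator {\<omega> \<in> space P. norm (M (Suc n) \<omega>) > u}) \<omega>
        \<le> c1 (iterate h a x0 M n \<omega>) * exp (- c2 (iterate h a x0 M n \<omega>) * u))"

definition beta :: "real \<Rightarrow> (nat \<Rightarrow> real) \<Rightarrow> nat \<Rightarrow> real" where
  "beta lam a n =
     (if n = 0 then 0
      else Max ((\<lambda>k. exp (- lam * (\<Sum>i\<in>{k+1..<n}. a i)) * a k) ` {0..<n}))"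

end

theory Submission
  imports Defs
begin

text \<open>
  Write \<open>A\<close> for the Jacobian of \<open>h\<close> at the equilibrium and split the iterates as \<open>x\<^sub>n = z\<^sub>n + Y\<^sub>n\<close>, where \<open>Y\<close>
  is the noise filtered through the linearised dynamics,
  \<open>Y\<^sub>n\<^sub>+\<^sub>1 = Y\<^sub>n + a\<^sub>n A Y\<^sub>n + a\<^sub>n M\<^sub>n\<^sub>+\<^sub>1\<close> with \<open>Y\<^sub>0 = 0\<close>. Then \<open>z\<close> contains no noise of its own:
  \<open>z\<^sub>n\<^sub>+\<^sub>1 = z\<^sub>n + a\<^sub>n (h (z\<^sub>n + Y\<^sub>n) - A Y\<^sub>n)\<close> is an Euler scheme for the limiting equation, perturbed
  by an amount of the order of \<open>Y\<close>. The theorem follows from a deterministic statement about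
  \<open>z\<close> on the event that all \<open>\<parallel>Y\<^sub>n\<parallel>\<close> are at most \<open>\<delta>\<close>, a small multiple of \<open>\<epsilon>\<close>, and from a concentration
  bound for each single \<open>Y\<^sub>n\<close>.

  Both halves measure vectors in a norm \<open>N\<close> adapted to \<open>A\<close>, the supremum over \<open>t \<ge> 0\<close> of
  \<open>e\<^bsup>lam' t\<^esup> \<parallel>e\<^bsup>t A\<^esup> x\<parallel>\<close>. It is equivalent to the Euclidean norm, and \<open>I + a A\<close> contracts it by
  \<open>e\<^bsup>- lam a\<^esup>\<close> for all small \<open>a\<close>, because \<open>lam < lam'\<close> leaves room for the quadratic error of the
  Euler step (\<open>adapted_norm_exists\<close>).

  Deterministic half (\<open>perturbed_euler_trapped\<close>). Outside a small ball around the equilibrium the Liapunov function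
  drops along \<open>z\<close> at a uniform rate, so \<open>z\<close> never leaves its initial sublevel set and reaches the
  ball within a bounded time; \<open>x\<close> stays within \<open>\<delta>\<close> of \<open>z\<close>, hence in the larger compact sublevel
  set. Inside the ball the linear part dominates, the ball is invariant, and \<open>N (z - xs)\<close> decays
  exponentially to the level \<open>\<delta>\<close>. Time of the order \<open>log (1 / \<epsilon>)\<close> therefore suffices to come
  within \<open>\<epsilon>\<close>.

  Probabilistic half (\<open>damped_noise_tail\<close>). The noise is switched off when the iterate is outside
  the compact sublevel set. This makes the conditional tails uniform, and on the good event it
  changes nothing, since there the iterate never leaves that set. A martingale difference with
  exponential tails has moment generating function at most \<open>exp (C q\<^sup>2)\<close> for small \<open>q\<close>. In \<open>Y\<^sub>n\<close>
  the increment with index \<open>k\<close> carries a weight of the order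
  \<open>w\<^sub>k = a\<^sub>k exp (- lam (a\<^sub>k\<^sub>+\<^sub>1 + \<dots> + a\<^sub>n\<^sub>-\<^sub>1))\<close>. The largest of these is \<open>\<beta>\<^sub>n\<close>, and since their sum is
  bounded, the sum of their squares is at most a constant times \<open>\<beta>\<^sub>n\<close>. Thus \<open>Y\<^sub>n\<close> has sub-Gaussian tails with
  variance proxy of order \<open>\<beta>\<^sub>n\<close> at the scales in question, and \<open>\<parallel>Y\<^sub>n\<parallel> > \<delta>\<close> has probability at
  most \<open>C1 exp (- C2 \<epsilon>\<^sup>2 / \<beta>\<^sub>n)\<close>. A union bound over \<open>n\<close> finishes the proof. The radius \<open>\<epsilon>\<close> is bounded by the radius
  of the compact sublevel set, which is what allows \<open>\<delta> = \<kappa> \<epsilon>\<close> with a fixed \<open>\<kappa>\<close>.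
\<close>

section \<open>The matrix exponential and a norm adapted to it\<close>

definition matpow :: "real^'n^'n \<Rightarrow> nat \<Rightarrow> real^'n^'n" where
  "matpow A k = ((\<lambda>X. A ** X) ^^ k) (mat 1)"

lemma matpow_0: "matpow A 0 = mat 1" and matpow_Suc: "matpow A (Suc k) = A ** matpow A k"
  by (simp_all add: matpow_def)

lemma matpow_add: "matpow A m ** matpow A n = matpow A (m + n)"
  by (induction m) (simp_all add: matpow_0 matpow_Suc flip: matrix_mul_assoc)

lemma matpow_scaleR: "matpow (t *\<^sub>R A) k = t ^ k *\<^sub>R matpow A k"
  by (induction k) (simp_all add: matpow_0 matpow_Suc matrix_scalar_ac flip: scalar_matrix_assoc)

lemma matpow_entry_bound:
  fixes A :: "real^'n^'n"
  shows "\<bar>matpow A k $ i $ j\<bar> \<le> (real CARD('n) * norm A) ^ k"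
proof (induction k arbitrary: i)
  case 0
  then show ?case by (simp add: matpow_0 mat_def)
next
  case (Suc k)
  have "\<bar>matpow A (Suc k) $ i $ j\<bar> \<le> (\<Sum>l\<in>UNIV. \<bar>A $ i $ l * matpow A k $ l $ j\<bar>)"
    by (simp add: matpow_Suc matrix_matrix_mult_def sum_abs)
  also have "\<dots> \<le> (\<Sum>l\<in>(UNIV::'n set). norm A * (real CARD('n) * norm A) ^ k)"
  proof (rule sum_mono)
    fix l
    have "\<bar>A $ i $ l\<bar> \<le> norm A"
      by (metis Finite_Cartesian_Product.norm_nth_le order_trans real_norm_def)
    then show "\<bar>A $ i $ l * matpow A k $ l $ j\<bar> \<le> norm A * (real CARD('n) * norm A) ^ k"
      unfolding abs_mult by (intro mult_mono Suc.IH) auto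
  qed
  finally show ?case by (simp add: mult.assoc)
qed

text \<open>
  The exponential of \<open>t A\<close> is studied entry by entry, so that its convergence, multiplication rule
  and remainder are statements about real series; this is the summand of the entry \<open>(i, j)\<close>.
\<close>
abbreviation exp_entry :: "real^'n^'n \<Rightarrow> 'n \<Rightarrow> 'n \<Rightarrow> real \<Rightarrow> nat \<Rightarrow> real" where
  "exp_entry A i j t k \<equiv> t ^ k / fact k * matpow A k $ i $ j"

lemma exp_entry_bound:
  fixes A :: "real^'n^'n"
  shows "\<bar>exp_entry A i j t k\<bar> \<le> \<bar>t\<bar> ^ k * ((real CARD('n) * norm A) ^ k / fact k)"
proof -
  have "\<bar>exp_entry A i j t k\<bar> = \<bar>t\<bar> ^ k / fact k * \<bar>matpow A k $ i $ j\<bar>"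
    by (simp add: abs_mult power_abs)
  also have "\<dots> \<le> \<bar>t\<bar> ^ k / fact k * (real CARD('n) * norm A) ^ k"
    by (intro mult_left_mono matpow_entry_bound) auto
  finally show ?thesis by simp
qed

lemma summable_exp_entry:
  fixes A :: "real^'n^'n"
  shows "summable (\<lambda>k. norm (exp_entry A i j t k))"
proof (rule summable_comparison_test)
  have "summable (\<lambda>k. (\<bar>t\<bar> * (real CARD('n) * norm A)) ^ k / fact k)"
    using summable_exp[of "\<bar>t\<bar> * (real CARD('n) * norm A)"] by (simp add: field_simps)
  then show "summable (\<lambda>k. \<bar>t\<bar> ^ k * ((real CARD('n) * norm A) ^ k / fact k))"
    by (simp add: power_mult_distrib)
  show "\<exists>N. \<forall>n\<ge>N. norm (norm (exp_entry A i j t n)) \<le> \<bar>t\<bar> ^ n * ((real CARD('n) * norm A) ^ n / fact n)"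
    using exp_entry_bound[of t _ A i j] by auto
qed

lemma matrix_exp_entry_sums:
  fixes A :: "real^'n^'n"
  shows "exp_entry A i j t sums (matrix_exp (t *\<^sub>R A) $ i $ j)"
proof -
  define E :: "real^'n^'n" where "E = (\<chi> i j. suminf (exp_entry A i j t))"
  have s: "exp_entry A i j t sums (E $ i $ j)" for i j
    using summable_norm_cancel[OF summable_exp_entry[of t A i j]]
    by (simp add: E_def summable_sums)
  have "(\<lambda>k. (1 / fact k) *\<^sub>R matpow (t *\<^sub>R A) k) sums E"
    unfolding sums_def
  proof (intro vec_tendstoI)
    fix i j
    show "(\<lambda>n. (\<Sum>k<n. (1 / fact k) *\<^sub>R matpow (t *\<^sub>R A) k) $ i $ j) \<longlonglongrightarrow> E $ i $ j"
      using s[of i j] by (simp add: sums_def matpow_scaleR)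
  qed
  then have "matrix_exp (t *\<^sub>R A) = E"
    unfolding matrix_exp_def matpow_def[symmetric] by (rule sums_unique[symmetric])
  with s show ?thesis by simp
qed

text \<open>
  Each product of entries is a Cauchy product of two real series; summing over the inner index
  turns the products of powers of \<open>A\<close> into a single power, and the binomial theorem collects the
  scalars.
\<close>
lemma matrix_exp_add:
  fixes A :: "real^'n^'n"
  shows "matrix_exp (s *\<^sub>R A) ** matrix_exp (t *\<^sub>R A) = matrix_exp ((s + t) *\<^sub>R A)"
proof -
  have "(matrix_exp (s *\<^sub>R A) ** matrix_exp (t *\<^sub>R A)) $ i $ j = matrix_exp ((s + t) *\<^sub>R A) $ i $ j"
    for i j
  proof -
    have "(\<lambda>k. \<Sum>m\<le>k. exp_entry A i l s m * exp_entry A l j t (k - m)) sums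
       (matrix_exp (s *\<^sub>R A) $ i $ l * matrix_exp (t *\<^sub>R A) $ l $ j)" for l
      using Cauchy_product_sums[OF summable_exp_entry[of s A i l] summable_exp_entry[of t A l j]]
      unfolding sums_unique[OF matrix_exp_entry_sums[of s A i l], symmetric]
        sums_unique[OF matrix_exp_entry_sums[of t A l j], symmetric] .
    then have "(\<lambda>k. \<Sum>l\<in>UNIV. \<Sum>m\<le>k. exp_entry A i l s m * exp_entry A l j t (k - m)) sums
        (\<Sum>l\<in>UNIV. matrix_exp (s *\<^sub>R A) $ i $ l * matrix_exp (t *\<^sub>R A) $ l $ j)"
      by (intro sums_sum)
    moreover have "(\<Sum>l\<in>UNIV. \<Sum>m\<le>k. exp_entry A i l s m * exp_entry A l j t (k - m))
        = exp_entry A i j (s + t) k" for k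
    proof -
      have "(\<Sum>l\<in>UNIV. \<Sum>m\<le>k. exp_entry A i l s m * exp_entry A l j t (k - m)) =
         (\<Sum>m\<le>k. \<Sum>l\<in>UNIV. s ^ m / fact m * (t ^ (k - m) / fact (k - m)) *
            (matpow A m $ i $ l * matpow A (k - m) $ l $ j))"
        by (subst sum.swap) (intro sum.cong refl, simp only: mult_ac)
      also have "\<dots> = (\<Sum>m\<le>k. s ^ m / fact m * (t ^ (k - m) / fact (k - m)) * matpow A k $ i $ j)"
      proof (rule sum.cong[OF refl])
        fix m assume "m \<in> {..k}"
        then have "matpow A m ** matpow A (k - m) = matpow A k"
          by (simp add: matpow_add)
        then have "(\<Sum>l\<in>UNIV. matpow A m $ i $ l * matpow A (k - m) $ l $ j) = matpow A k $ i $ j"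
          by (auto simp: matrix_matrix_mult_def vec_eq_iff)
        then show "(\<Sum>l\<in>UNIV. s ^ m / fact m * (t ^ (k - m) / fact (k - m)) *
            (matpow A m $ i $ l * matpow A (k - m) $ l $ j)) =
            s ^ m / fact m * (t ^ (k - m) / fact (k - m)) * matpow A k $ i $ j"
          unfolding sum_distrib_left[symmetric] by simp
      qed
      also have "\<dots> = exp_entry A i j (s + t) k"
      proof -
        have "(s + t) ^ k / fact k = (\<Sum>m\<le>k. s ^ m / fact m * (t ^ (k - m) / fact (k - m)))"
          unfolding binomial_ring sum_divide_distrib
          by (intro sum.cong refl) (simp add: binomial_fact)
        then show ?thesis by (simp add: sum_distrib_right)
      qed
      finally show ?thesis .
    qed
    ultimately have "exp_entry A i j (s + t) sums
        (\<Sum>l\<in>UNIV. matrix_exp (s *\<^sub>R A) $ i $ l * matrix_exp (t *\<^sub>R A) $ l $ j)"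
      by (simp only:)
    from sums_unique2[OF this matrix_exp_entry_sums] show ?thesis
      by (simp add: matrix_matrix_mult_def)
  qed
  then show ?thesis by (simp add: vec_eq_iff)
qed

lemma matrix_exp_0: "matrix_exp (0 *\<^sub>R (A::real^'n^'n)) = mat 1"
proof -
  have "matrix_exp (0 *\<^sub>R A) $ i $ j = (mat 1 :: real^'n^'n) $ i $ j" for i j
  proof -
    have "(\<lambda>k. exp_entry A i j 0 k) = (\<lambda>k. if k = 0 then mat 1 $ i $ j else 0)"
      by (auto simp: fun_eq_iff matpow_0)
    then have "exp_entry A i j 0 sums ((mat 1 :: real^'n^'n) $ i $ j)"
      using sums_single[of 0 "\<lambda>_. (mat 1 :: real^'n^'n) $ i $ j"] by simp
    from sums_unique2[OF matrix_exp_entry_sums this] show ?thesis .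
  qed
  then show ?thesis by (simp add: vec_eq_iff)
qed

lemma matrix_exp_remainder:
  fixes A :: "real^'n^'n"
  assumes "0 \<le> t" "t \<le> 1"
  shows "norm (matrix_exp (t *\<^sub>R A) *v x - (x + t *\<^sub>R (A *v x)))
    \<le> (real CARD('n))\<^sup>2 * exp (real CARD('n) * norm A) * t\<^sup>2 * norm x"
proof -
  define c where "c = real CARD('n) * norm A"
  have c0: "0 \<le> c" by (simp add: c_def)
  define R where "R = matrix_exp (t *\<^sub>R A) - (mat 1 + t *\<^sub>R A)"
  have R: "\<bar>R $ i $ j\<bar> \<le> t\<^sup>2 * exp c" for i j
  proof -
    have "(\<lambda>k. exp_entry A i j t (k + 2)) sums (matrix_exp (t *\<^sub>R A) $ i $ j - (\<Sum>k<2. exp_entry A i j t k))"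
      by (rule sums_split_initial_segment[OF matrix_exp_entry_sums])
    moreover have "(\<Sum>k<2. exp_entry A i j t k) = (mat 1 + t *\<^sub>R A) $ i $ j"
      by (simp add: numeral_2_eq_2 matpow_0 matpow_Suc)
    ultimately have 1: "(\<lambda>k. exp_entry A i j t (k + 2)) sums (R $ i $ j)"
      by (simp add: R_def)
    have e: "(\<lambda>k. c ^ k / fact k) sums exp c"
      using exp_converges[of c] by (simp add: field_simps)
    have 2: "(\<lambda>k. t\<^sup>2 * (c ^ (k + 2) / fact (k + 2))) sums (t\<^sup>2 * (exp c - (\<Sum>k<2. c ^ k / fact k)))"
      by (intro sums_mult sums_split_initial_segment e)
    have "\<bar>R $ i $ j\<bar> \<le> t\<^sup>2 * (exp c - (\<Sum>k<2. c ^ k / fact k))"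
    proof -
      have b: "\<bar>exp_entry A i j t (k + 2)\<bar> \<le> t\<^sup>2 * (c ^ (k + 2) / fact (k + 2))" for k
      proof -
        have "\<bar>t\<bar> ^ (k + 2) \<le> t\<^sup>2"
          unfolding power_add
          using assms by (simp add: power_add mult_left_le_one_le power_le_one del: power_Suc)
        then have "\<bar>t\<bar> ^ (k + 2) * (c ^ (k + 2) / fact (k + 2)) \<le> t\<^sup>2 * (c ^ (k + 2) / fact (k + 2))"
          using c0 by (intro mult_right_mono) auto
        then show ?thesis
          using exp_entry_bound[of t "k+2" A i j] unfolding c_def by linarith
      qed
      have "norm (\<Sum>k. exp_entry A i j t (k + 2)) \<le> (\<Sum>k. t\<^sup>2 * (c ^ (k + 2) / fact (k + 2)))"
        by (rule norm_suminf_le) (use b 2 in \<open>auto simp: sums_iff\<close>)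
      then show ?thesis using 1 2 by (simp add: sums_iff)
    qed
    also have "\<dots> \<le> t\<^sup>2 * exp c"
      using c0 by (intro mult_left_mono) (auto simp: numeral_2_eq_2)
    finally show ?thesis .
  qed
  have "matrix_exp (t *\<^sub>R A) *v x - (x + t *\<^sub>R (A *v x)) = R *v x"
    by (simp add: R_def matrix_vector_mult_diff_rdistrib matrix_vector_mult_add_rdistrib
        scaleR_matrix_vector_assoc)
  also have "norm \<dots> \<le> onorm ((*v) R) * norm x"
    by (rule onorm) (simp add: matrix_vector_mul_bounded_linear)
  also have "\<dots> \<le> (real CARD('n) * real CARD('n) * (t\<^sup>2 * exp c)) * norm x"
    by (intro mult_right_mono onorm_le_matrix_component R) auto
  finally show ?thesis by (simp add: c_def power2_eq_square mult_ac)
qed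

text \<open>
  The supremum of \<open>e\<^bsup>lam' t\<^esup> \<parallel>e\<^bsup>t A\<^esup> x\<parallel>\<close> over \<open>t \<ge> 0\<close> shrinks under \<open>e\<^bsup>a A\<^esup>\<close> by the
  factor \<open>e\<^bsup>- lam' a\<^esup>\<close> or more, by the semigroup property, with no constant in front. Contraction per step is
  what the induction along the step sizes needs: a constant would be picked up once per step.
  Replacing \<open>e\<^bsup>a A\<^esup>\<close> by \<open>I + a A\<close> costs \<open>O(a\<^sup>2)\<close>, which the gap between \<open>lam\<close> and \<open>lam'\<close> absorbs for small \<open>a\<close>.
\<close>
lemma adapted_norm_exists:
  fixes A :: "real^'n^'n"
  assumes "admissible_rate A lam"
  obtains N :: "real^'n \<Rightarrow> real" and K a0 :: real
  where "0 < lam" "1 \<le> K" "0 < a0"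
    "\<And>x y. N (x + y) \<le> N x + N y"
    "\<And>x. norm x \<le> N x" "\<And>x. N x \<le> K * norm x"
    "\<And>a x. 0 \<le> a \<Longrightarrow> a \<le> a0 \<Longrightarrow> N (x + a *\<^sub>R (A *v x)) \<le> exp (- lam * a) * N x"
proof -
  obtain lam' \<kappa> K where k: "0 < lam'" "0 < \<kappa>" "\<kappa> < 1" "1 \<le> K"
     and bound: "\<And>t. 0 \<le> t \<Longrightarrow> spectral_norm (matrix_exp (t *\<^sub>R A)) \<le> K * exp (- lam' * t)"
     and lam: "lam = (1 - \<kappa>) / K\<^sup>2 * lam'"
    using assms unfolding admissible_rate_def by blast
  have K2: "1 \<le> K\<^sup>2" using k by (simp add: one_le_power)
  have lam0: "0 < lam" using k lam K2 by (auto intro!: mult_pos_pos divide_pos_pos)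
  have lam1: "lam < lam'"
  proof -
    have "(1 - \<kappa>) / K\<^sup>2 < 1" 
    proof -
      have "1 - \<kappa> < K\<^sup>2" using k K2 by linarith
      then show ?thesis using K2 by (simp add: divide_less_eq)
    qed
    then have "(1 - \<kappa>) / K\<^sup>2 * lam' < 1 * lam'" using k(1) by (intro mult_strict_right_mono)
    then show ?thesis by (simp add: lam)
  qed
  define E where "E t = matrix_exp (t *\<^sub>R A)" for t
  define g where "g x t = exp (lam' * t) * norm (E t *v x)" for x t
  define N where "N x = (SUP t\<in>{0..}. g x t)" for x
  have gK: "g x t \<le> K * norm x" if "0 \<le> t" for x t
  proof -
    have "norm (E t *v x) \<le> spectral_norm (E t) * norm x"
      unfolding spectral_norm_def by (rule onorm) (simp add: matrix_vector_mul_bounded_linear)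
    also have "\<dots> \<le> K * exp (- lam' * t) * norm x"
      using bound[OF that] by (intro mult_right_mono) (auto simp: E_def)
    finally have "g x t \<le> exp (lam' * t) * (K * exp (- lam' * t) * norm x)"
      unfolding g_def by (intro mult_left_mono) auto
    also have "\<dots> = K * norm x * (exp (lam' * t) * exp (- lam' * t))" by simp
    also have "\<dots> = K * norm x" by (simp flip: exp_add)
    finally show ?thesis .
  qed
  have bdd: "bdd_above (g x ` {0..})" for x
    by (rule bdd_aboveI[of _ "K * norm x"]) (auto simp: gK)
  have gN: "g x t \<le> N x" if "0 \<le> t" for x t
    unfolding N_def by (rule cSUP_upper[OF _ bdd]) (use that in auto)
  have N_le: "N x \<le> c" if "\<And>t. 0 \<le> t \<Longrightarrow> g x t \<le> c" for x c
    unfolding N_def by (rule cSUP_least) (use that in auto)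
  have NK: "N x \<le> K * norm x" for x by (rule N_le) (rule gK)
  have nN: "norm x \<le> N x" for x
    using gN[of 0 x] by (simp add: g_def E_def matrix_exp_0[simplified])
  have Nadd: "N (x + y) \<le> N x + N y" for x y
  proof (rule N_le)
    fix t :: real assume "0 \<le> t"
    have "g (x + y) t \<le> g x t + g y t"
      unfolding g_def matrix_vector_right_distrib
      by (simp flip: distrib_left) (rule norm_triangle_ineq)
    then show "g (x + y) t \<le> N x + N y" using gN[OF \<open>0 \<le> t\<close>, of x] gN[OF \<open>0 \<le> t\<close>, of y] by linarith
  qed
  have NE: "N (E a *v x) \<le> exp (- lam' * a) * N x" if "0 \<le> a" for a x
  proof (rule N_le)
    fix t :: real assume t: "0 \<le> t"
    have "g (E a *v x) t = exp (lam' * t) * norm (E (t + a) *v x)"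
      by (simp add: g_def E_def matrix_vector_mul_assoc matrix_exp_add)
    also have "\<dots> = exp (- lam' * a) * g x (t + a)"
    proof -
      have "exp (lam' * t) = exp (- lam' * a) * exp (lam' * (t + a))"
        by (simp add: distrib_left flip: exp_add)
      then show ?thesis unfolding g_def by simp
    qed
    also have "\<dots> \<le> exp (- lam' * a) * N x"
      using that t by (intro mult_left_mono gN) auto
    finally show "g (E a *v x) t \<le> exp (- lam' * a) * N x" .
  qed
  define C where "C = K * ((real CARD('n))\<^sup>2 * exp (real CARD('n) * norm A))"
  have C0: "0 < C" using k by (simp add: C_def)
  \<comment> \<open>Chosen so that \<open>C a \<le> exp (- lam') (lam' - lam)\<close>, which bounds \<open>C a\<^sup>2\<close> by the difference of the two exponentials.\<close>
  define a0 where "a0 = min 1 (exp (- lam') * (lam' - lam) / C)"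
  have a0: "0 < a0" using C0 lam1 by (simp add: a0_def)
  have main: "N (x + a *\<^sub>R (A *v x)) \<le> exp (- lam * a) * N x" if a: "0 \<le> a" "a \<le> a0" for a x
  proof -
    have a1: "a \<le> 1" and aC: "a \<le> exp (- lam') * (lam' - lam) / C" using a by (auto simp: a0_def)
    let ?r = "(x + a *\<^sub>R (A *v x)) - E a *v x"
    have "norm ?r \<le> (real CARD('n))\<^sup>2 * exp (real CARD('n) * norm A) * a\<^sup>2 * norm x"
      using matrix_exp_remainder[OF a(1) a1, of A x] by (simp add: E_def norm_minus_commute)
    then have "K * norm ?r \<le> K * ((real CARD('n))\<^sup>2 * exp (real CARD('n) * norm A) * a\<^sup>2 * norm x)"
      using k by (intro mult_left_mono) auto
    also have "\<dots> = C * a\<^sup>2 * norm x" by (simp add: C_def mult_ac)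
    also have "\<dots> \<le> C * a\<^sup>2 * N x" using C0 nN by (intro mult_left_mono) auto
    finally have "N ?r \<le> C * a\<^sup>2 * N x" using NK[of ?r] by linarith
    moreover have "N (x + a *\<^sub>R (A *v x)) \<le> N (E a *v x) + N ?r"
      using Nadd[of "E a *v x" ?r] by simp
    ultimately have "N (x + a *\<^sub>R (A *v x)) \<le> (exp (- lam' * a) + C * a\<^sup>2) * N x"
      using NE[OF a(1), of x] by (simp add: distrib_right)
    also have "\<dots> \<le> exp (- lam * a) * N x"
    proof (rule mult_right_mono)
      have "C * a \<le> exp (- lam') * (lam' - lam)"
        using aC C0 by (simp add: field_simps)
      then have "C * a * a \<le> exp (- lam') * (lam' - lam) * a" using a by (intro mult_right_mono) auto
      also have "\<dots> \<le> exp (- lam' * a) * ((lam' - lam) * a)"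
      proof -
        have "lam' * a \<le> lam'" using a1 k by simp
        then have "exp (- lam') \<le> exp (- lam' * a)" by simp
        then show ?thesis using a lam1 unfolding mult.assoc by (intro mult_right_mono) auto
      qed
      also have "\<dots> \<le> exp (- lam' * a) * (exp ((lam' - lam) * a) - 1)"
      proof (rule mult_left_mono)
        show "(lam' - lam) * a \<le> exp ((lam' - lam) * a) - 1"
          using exp_ge_add_one_self[of "(lam' - lam) * a"] by linarith
      qed simp
      also have "\<dots> = exp (- lam * a) - exp (- lam' * a)"
      proof -
        have "exp (- lam' * a) * exp ((lam' - lam) * a) = exp (- lam * a)"
          by (simp add: left_diff_distrib flip: exp_add)
        then show ?thesis unfolding right_diff_distrib by simp
      qed
      finally show "exp (- lam' * a) + C * a\<^sup>2 \<le> exp (- lam * a)"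
        by (simp add: power2_eq_square mult.assoc)
      show "0 \<le> N x" using nN[of x] norm_ge_zero[of x] by linarith
    qed
    finally show ?thesis .
  qed
  show ?thesis by (rule that[OF lam0 k(4) a0 Nadd nN NK main])
qed

section \<open>Deterministic analysis of the perturbed Euler scheme\<close>

text \<open>
  One step of the perturbed Euler scheme near the equilibrium. There \<open>h (xs + w) = A w + q\<close> with
  \<open>\<parallel>q\<parallel> \<le> \<eta> \<parallel>w\<parallel>\<close>, and the choice \<open>\<eta> = lam / (4 K)\<close> lets the error use up only part of the
  contraction of the linear step. The outcome is a convex combination of the old distance and
  \<open>\<delta>\<close>, so \<open>\<delta>\<close> is the level to which the distance decays.
\<close>
lemma local_contraction:
  fixes N :: "real^'n \<Rightarrow> real" and A :: "real^'n^'n" and h :: "real^'n \<Rightarrow> real^'n"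
  assumes lam: "0 < lam" and K: "1 \<le> K" and a0: "0 < a0"
    and Nadd: "\<And>x y. N (x + y) \<le> N x + N y"
    and nN: "\<And>x. norm x \<le> N x" and NK: "\<And>x. N x \<le> K * norm x"
    and NA: "\<And>a x. 0 \<le> a \<Longrightarrow> a \<le> a0 \<Longrightarrow> N (x + a *\<^sub>R (A *v x)) \<le> exp (- lam * a) * N x"
    and h: "(h has_derivative (\<lambda>v. A *v v)) (at xs)" and h0: "h xs = 0"
  obtains \<rho> where "0 < \<rho>"
    "\<And>z y a \<delta>. N (z - xs) \<le> \<rho> \<Longrightarrow> norm y \<le> \<delta> \<Longrightarrow> \<delta> \<le> \<rho> \<Longrightarrow> 0 \<le> a \<Longrightarrow> a \<le> a0 \<Longrightarrow> lam * a \<le> 1 \<Longrightarrow>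
      N (z + a *\<^sub>R (h (z + y) - A *v y) - xs) \<le> (1 - a * (lam / 4)) * N (z - xs) + a * (lam / 4) * \<delta>"
proof -
  define \<eta> where "\<eta> = lam / (4 * K)"
  have \<eta>: "0 < \<eta>" using lam K by (simp add: \<eta>_def)
  have K\<eta>: "K * \<eta> = lam / 4" using K by (simp add: \<eta>_def)
  obtain d where d: "0 < d" and dd: "\<And>y. norm (y - xs) < d \<Longrightarrow>
      norm (h y - h xs - A *v (y - xs)) \<le> \<eta> * norm (y - xs)"
    using h \<eta> unfolding has_derivative_at_alt by blast
  define \<rho> where "\<rho> = d / 3"
  have "N (z + a *\<^sub>R (h (z + y) - A *v y) - xs) \<le> (1 - a * (lam / 4)) * N (z - xs) + a * (lam / 4) * \<delta>"
    if z: "N (z - xs) \<le> \<rho>" and y: "norm y \<le> \<delta>" and \<delta>: "\<delta> \<le> \<rho>"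
      and a: "0 \<le> a" "a \<le> a0" "lam * a \<le> 1" for z y a \<delta>
  proof -
    define q where "q = h (z + y) - A *v (z + y - xs)"
    define w where "w = z - xs"
    have nw: "norm w \<le> N w" by (rule nN)
    have zy: "norm (z + y - xs) \<le> norm w + norm y"
      unfolding w_def using norm_triangle_ineq[of "z - xs" y] by (simp add: algebra_simps)
    have "norm (z + y - xs) < d"
      using zy nw z y \<delta> d unfolding w_def \<rho>_def by linarith
    then have "norm q \<le> \<eta> * norm (z + y - xs)"
      using dd[of "z + y"] h0 by (simp add: q_def)
    also have "\<dots> \<le> \<eta> * (N w + \<delta>)" using zy nw y \<eta> by (intro mult_left_mono) auto
    finally have q: "norm q \<le> \<eta> * (N w + \<delta>)" .
    have "z + a *\<^sub>R (h (z + y) - A *v y) - xs = (w + a *\<^sub>R (A *v w)) + a *\<^sub>R q"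
      by (simp add: q_def w_def algebra_simps matrix_vector_mult_diff_distrib)
    then have "N (z + a *\<^sub>R (h (z + y) - A *v y) - xs) \<le> N (w + a *\<^sub>R (A *v w)) + N (a *\<^sub>R q)"
      using Nadd by metis
    also have "\<dots> \<le> exp (- lam * a) * N w + a * (lam / 4) * (N w + \<delta>)"
    proof -
      have "N (a *\<^sub>R q) \<le> K * norm (a *\<^sub>R q)" by (rule NK)
      also have "\<dots> = K * a * norm q" using a by simp
      also have "\<dots> \<le> K * a * (\<eta> * (N w + \<delta>))" using K a q by (intro mult_left_mono) auto
      also have "\<dots> = a * (K * \<eta>) * (N w + \<delta>)" by simp
      finally show ?thesis using NA[OF a(1,2), of w] unfolding K\<eta> by linarith
    qed
    also have "exp (- lam * a) * N w \<le> (1 - lam * a / 2) * N w"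
    proof (rule mult_right_mono)
      define u where "u = lam * a"
      have u: "0 \<le> u" "u \<le> 1" using a lam by (auto simp: u_def)
      have "exp (- u) \<le> 1 / (1 + u)"
        using exp_ge_add_one_self[of u] u by (simp add: exp_minus field_simps)
      also have "\<dots> \<le> 1 - u / 2"
      proof -
        have "u * u \<le> u" using u by (simp add: mult_left_le)
        then show ?thesis using u by (simp add: field_simps)
      qed
      finally show "exp (- lam * a) \<le> 1 - lam * a / 2" by (simp add: u_def)
      show "0 \<le> N w" using nw norm_ge_zero[of w] by linarith
    qed
    finally have "N (z + a *\<^sub>R (h (z + y) - A *v y) - xs)
        \<le> (1 - lam * a / 2) * N w + a * (lam / 4) * (N w + \<delta>)" by simp
    also have "\<dots> = (1 - a * (lam / 4)) * N w + a * (lam / 4) * \<delta>"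
      by (simp add: field_simps)
    finally show ?thesis unfolding w_def .
  qed
  with d show ?thesis by (intro that[of \<rho>]) (auto simp: \<rho>_def)
qed

text \<open>
  Away from the equilibrium \<open>gV x \<bullet> h x\<close> is bounded away from \<open>0\<close> on the compact sublevel set.
  Uniform continuity keeps it so when the gradient is evaluated along the segment of the step and
  \<open>h\<close> at a perturbed point; the mean value theorem then gives the decrease of \<open>V\<close>.
\<close>
lemma liapunov_drift:
  fixes V :: "real^'n \<Rightarrow> real" and A :: "real^'n^'n" and h :: "real^'n \<Rightarrow> real^'n"
  assumes L: "liapunov_function h xs D V" and cpt: "compact (sublevel D V r)"
    and h: "continuous_on UNIV h" and \<rho>: "0 < \<rho>"
  obtains \<gamma> \<sigma> where "0 < \<gamma>" "0 < \<sigma>"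
    "\<And>z y a. z \<in> sublevel D V r \<Longrightarrow> \<rho> \<le> norm (z - xs) \<Longrightarrow> norm y \<le> \<sigma> \<Longrightarrow> 0 \<le> a \<Longrightarrow> a \<le> \<sigma> \<Longrightarrow>
      z + a *\<^sub>R (h (z + y) - A *v y) \<in> D \<and> V (z + a *\<^sub>R (h (z + y) - A *v y)) \<le> V z - a * \<gamma>"
proof -
  define C where "C = sublevel D V r \<inter> {x. \<rho> \<le> norm (x - xs)}"
  obtain gV where D: "open D" and gV: "continuous_on D gV" "\<And>x. x \<in> D \<Longrightarrow> GDERIV V x :> gV x"
    and neg: "\<And>x. x \<in> D \<Longrightarrow> x \<noteq> xs \<Longrightarrow> gV x \<bullet> h x < 0"
    using L unfolding liapunov_function_def by blast
  have "closed {x. \<rho> \<le> norm (x - xs)}"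
    by (intro closed_Collect_le continuous_intros)
  then have C: "compact C" unfolding C_def using cpt by blast
  have CD: "C \<subseteq> D" by (auto simp: C_def sublevel_def)
  show ?thesis
  proof (cases "C = {}")
    case True
    then show ?thesis by (intro that[of 1 1]) (auto simp: C_def)
  next
    case False
    obtain e where e: "0 < e" "(\<Union>x\<in>C. ball x e) \<subseteq> D"
      using compact_subset_open_imp_ball_epsilon_subset[OF C D CD] by blast
    define X where "X = C \<times> cball (0::real^'n) (e/2) \<times> cball (0::real^'n) (e/2)"
    \<comment> \<open>The derivative of \<open>V\<close> along a step, as a function of the base point, the noise and the displacement.\<close>
    define F where "F = (\<lambda>(z, y, p). gV (z + p) \<bullet> (h (z + y) - A *v y))"
    have inD: "z + p \<in> D" if "z \<in> C" "norm p \<le> e/2" for z p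
    proof -
      have "z + p \<in> ball z e" using that e by (simp add: dist_norm)
      then show ?thesis using e that by blast
    qed
    have X: "compact X" unfolding X_def by (intro compact_Times C compact_cball)
    have cF: "continuous_on X F"
    proof -
      have "continuous_on X (\<lambda>x. gV (fst x + snd (snd x)) \<bullet> (h (fst x + fst (snd x)) - A *v (fst (snd x))))"
      proof (intro continuous_intros)
        show "continuous_on X (\<lambda>x. gV (fst x + snd (snd x)))"
          by (rule continuous_on_compose2[OF gV(1)]) (auto intro!: continuous_intros inD simp: X_def)
        show "continuous_on X (\<lambda>x. h (fst x + fst (snd x)))"
          by (rule continuous_on_compose2[OF h]) (auto intro!: continuous_intros)
        show "continuous_on X (\<lambda>x. A *v fst (snd x))"
          by (rule continuous_on_compose2[OF linear_continuous_on[OF matrix_vector_mul_bounded_linear[of A], of UNIV]])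
             (auto intro!: continuous_intros)
      qed
      then show ?thesis by (simp add: F_def case_prod_unfold)
    qed
    have "continuous_on C (\<lambda>z. F (z, 0, 0))"
      by (rule continuous_on_compose2[OF cF]) (use e in \<open>auto intro!: continuous_intros simp: X_def\<close>)
    then obtain zm where zm: "zm \<in> C" "\<And>z. z \<in> C \<Longrightarrow> F (z, 0, 0) \<le> F (zm, 0, 0)"
      using continuous_attains_sup[OF C False] by metis
    have Fm: "F (zm, 0, 0) < 0"
    proof -
      have "zm \<noteq> xs" using zm(1) \<rho> by (auto simp: C_def)
      then show ?thesis using neg[of zm] zm(1) CD by (auto simp: F_def)
    qed
    define \<gamma> where "\<gamma> = - F (zm, 0, 0) / 2"
    have \<gamma>: "0 < \<gamma>" using Fm by (simp add: \<gamma>_def)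
    obtain d where d: "0 < d" "\<And>x x'. x \<in> X \<Longrightarrow> x' \<in> X \<Longrightarrow> dist x' x < d \<Longrightarrow> dist (F x') (F x) < \<gamma>"
      using compact_uniformly_continuous[OF cF X] \<gamma> unfolding uniformly_continuous_on_def by metis
    have Fneg: "F (z, y, p) \<le> - \<gamma>" if "z \<in> C" "norm y \<le> min (e/2) (d/3)" "norm p \<le> min (e/2) (d/3)" for z y p
    proof -
      have "dist (z, y, p) (z, 0, 0) \<le> dist (y, p) (0, 0)" by (simp add: dist_Pair_Pair)
      also have "\<dots> \<le> norm y + norm p"
        using norm_Pair_le[of y p] by (simp add: dist_norm)
      also have "\<dots> < d" using that d by simp
      finally have "dist (F (z, y, p)) (F (z, 0, 0)) < \<gamma>"
        using that e by (intro d(2)) (auto simp: X_def)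
      then show ?thesis using zm(2)[OF that(1)] by (simp add: dist_real_def \<gamma>_def abs_if split: if_splits)
    qed
    have "compact ((\<lambda>(z, y, p). h (z + y) - A *v y) ` X)"
    proof (rule compact_continuous_image[OF _ X])
      have "continuous_on X (\<lambda>x. h (fst x + fst (snd x)) - A *v (fst (snd x)))"
      proof (intro continuous_intros)
        show "continuous_on X (\<lambda>x. h (fst x + fst (snd x)))"
          by (rule continuous_on_compose2[OF h]) (auto intro!: continuous_intros)
        show "continuous_on X (\<lambda>x. A *v fst (snd x))"
          by (rule continuous_on_compose2[OF linear_continuous_on[OF matrix_vector_mul_bounded_linear[of A], of UNIV]])
             (auto intro!: continuous_intros)
      qed
      then show "continuous_on X (\<lambda>(z, y, p). h (z + y) - A *v y)" by (simp add: case_prod_unfold)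
    qed
    from compact_imp_bounded[OF this]
    obtain W where W: "0 < W" "\<And>x. x \<in> (\<lambda>(z, y, p). h (z + y) - A *v y) ` X \<Longrightarrow> norm x \<le> W"
      unfolding bounded_pos by blast
    define \<sigma> where "\<sigma> = min (min (e/2) (d/3)) (min (e/2) (d/3) / W)"
    have \<sigma>: "0 < \<sigma>" using e d W by (simp add: \<sigma>_def)
    have "z + a *\<^sub>R (h (z + y) - A *v y) \<in> D \<and> V (z + a *\<^sub>R (h (z + y) - A *v y)) \<le> V z - a * \<gamma>"
      if z: "z \<in> sublevel D V r" "\<rho> \<le> norm (z - xs)" and y: "norm y \<le> \<sigma>" and a: "0 \<le> a" "a \<le> \<sigma>" for z y a
    proof -
      define w where "w = h (z + y) - A *v y"
      have zC: "z \<in> C" using z by (simp add: C_def)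
      have y': "norm y \<le> min (e/2) (d/3)" using y by (auto simp: \<sigma>_def)
      have "(z, y, 0) \<in> X" using zC y' e by (auto simp: X_def)
      then have nw: "norm w \<le> W" using W(2)[of w] by (force simp: w_def)
      have sw: "norm (s *\<^sub>R w) \<le> min (e/2) (d/3)" if "0 \<le> s" "s \<le> a" for s
      proof -
        have "norm (s *\<^sub>R w) \<le> \<sigma> * W"
          using that a nw W \<sigma> by (auto intro!: mult_mono)
        also have "\<dots> \<le> (min (e/2) (d/3) / W) * W" using W by (intro mult_right_mono) (auto simp: \<sigma>_def)
        finally show ?thesis using W by simp
      qed
      have inD': "z + s *\<^sub>R w \<in> D" if "0 \<le> s" "s \<le> a" for s
        using inD[OF zC] sw[OF that] by simp
      have der: "((\<lambda>s. V (z + s *\<^sub>R w) + s * \<gamma>) has_real_derivative gV (z + s *\<^sub>R w) \<bullet> w + \<gamma>) (at s)"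
        if s: "0 \<le> s" "s \<le> a" for s
      proof -
        have "(V has_derivative (\<lambda>h. h \<bullet> gV (z + s *\<^sub>R w))) (at (z + s *\<^sub>R w))"
          using gV(2)[OF inD'[OF s]] by (simp add: gderiv_def)
        then have "((\<lambda>s. V (z + s *\<^sub>R w)) has_derivative (\<lambda>t. (t *\<^sub>R w) \<bullet> gV (z + s *\<^sub>R w))) (at s)"
          by (rule has_derivative_compose[rotated]) (auto intro!: derivative_eq_intros)
        then have "((\<lambda>s. V (z + s *\<^sub>R w)) has_real_derivative gV (z + s *\<^sub>R w) \<bullet> w) (at s)"
          by (simp add: has_field_derivative_def inner_commute mult.commute mult_commute_abs)
        then show ?thesis by (auto intro!: derivative_eq_intros)
      qed
      have "V (z + a *\<^sub>R w) + a * \<gamma> \<le> V (z + 0 *\<^sub>R w) + 0 * \<gamma>"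
      proof (rule DERIV_nonpos_imp_nonincreasing[OF a(1)])
        fix s assume s: "0 \<le> s" "s \<le> a"
        have "F (z, y, s *\<^sub>R w) \<le> - \<gamma>" by (rule Fneg[OF zC y' sw[OF s]])
        then have "gV (z + s *\<^sub>R w) \<bullet> w + \<gamma> \<le> 0" by (simp add: F_def w_def)
        then show "\<exists>y. ((\<lambda>s. V (z + s *\<^sub>R w) + s * \<gamma>) has_real_derivative y) (at s) \<and> y \<le> 0"
          using der[OF s] by blast
      qed
      then show ?thesis using inD'[of a] a by (simp add: w_def)
    qed
    with \<gamma> \<sigma> show ?thesis by (rule that)
  qed
qed

text \<open>
  The deterministic half of the argument as a property of the constants: \<open>\<sigma>\<close> bounds the step
  sizes and the noise, and \<open>T1\<close> is the time by which \<open>x - Y\<close> has entered the ball of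
  radius \<open>\<rho>\<close> in the adapted norm. The recursion is required only at iterates in the outer sublevel set, because that is where
  the truncated noise agrees with the true one; that they stay there is shown along the way.
\<close>
definition euler_trapping ::
  "(real^'n \<Rightarrow> real^'n) \<Rightarrow> real^'n^'n \<Rightarrow> (real^'n) set \<Rightarrow> (real^'n \<Rightarrow> real) \<Rightarrow> real^'n \<Rightarrow>
   real \<Rightarrow> real \<Rightarrow> real \<Rightarrow> real \<Rightarrow> real \<Rightarrow> bool" where
  "euler_trapping h A D V xs r lam \<rho> \<sigma> T1 \<longleftrightarrow>
     (\<forall>r0 \<delta> a x Y.
        r0 \<le> r \<and> \<delta> \<le> \<rho> \<and> \<delta> \<le> \<sigma> \<and> (\<forall>n. 0 < a n \<and> a n \<le> \<sigma>) \<and>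
        nbhd \<delta> (sublevel D V r0) \<subseteq> sublevel D V r \<and> (\<forall>n. norm (Y n) \<le> \<delta>) \<and>
        x 0 - Y 0 \<in> sublevel D V r0 \<and>
        (\<forall>n. x n \<in> sublevel D V r \<longrightarrow>
           x (Suc n) - Y (Suc n) = (x n - Y n) + a n *\<^sub>R (h (x n) - A *v Y n)) \<longrightarrow>
        (\<forall>n. T1 < time_grid a n \<longrightarrow>
           norm (x n - xs) \<le> 2 * \<delta> + \<rho> * exp (- (lam / 4) * (time_grid a n - T1))))"

text \<open>
  At every time the scheme is in one of two phases. Either \<open>z\<close> is still outside the small ball but inside
  its initial sublevel set, with \<open>V\<close> decreasing at rate \<open>\<gamma>\<close>, or it is in the ball and its
  distance from the equilibrium obeys the exponential bound. As \<open>V \<ge> 0\<close>, the first phase is over at time \<open>r / \<gamma>\<close>, and up to that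
  time the exponential bound is weaker than \<open>N (z - xs) \<le> \<rho>\<close>, so entering the ball establishes it.
\<close>
lemma perturbed_euler_trapped:
  fixes N :: "real^'n \<Rightarrow> real" and A :: "real^'n^'n" and h :: "real^'n \<Rightarrow> real^'n"
    and V :: "real^'n \<Rightarrow> real"
  assumes lam: "0 < lam" and K: "1 \<le> K" and a0: "0 < a0"
    and Nadd: "\<And>x y. N (x + y) \<le> N x + N y"
    and nN: "\<And>x. norm x \<le> N x" and NK: "\<And>x. N x \<le> K * norm x"
    and NA: "\<And>a x. 0 \<le> a \<Longrightarrow> a \<le> a0 \<Longrightarrow> N (x + a *\<^sub>R (A *v x)) \<le> exp (- lam * a) * N x"
    and h: "(h has_derivative (\<lambda>v. A *v v)) (at xs)" and h0: "h xs = 0"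
    and hc: "continuous_on UNIV h"
    and L: "liapunov_function h xs D V" and r: "0 < r" and cpt: "compact (sublevel D V r)"
  obtains \<rho> \<sigma> T1 where "0 < \<rho>" "\<rho> \<le> 1/2" "0 < \<sigma>" "0 \<le> T1"
    "euler_trapping h A D V xs r lam \<rho> \<sigma> T1"
proof -
  obtain \<rho>1 where \<rho>1: "0 < \<rho>1" and contr:
    "\<And>z y a \<delta>. N (z - xs) \<le> \<rho>1 \<Longrightarrow> norm y \<le> \<delta> \<Longrightarrow> \<delta> \<le> \<rho>1 \<Longrightarrow> 0 \<le> a \<Longrightarrow> a \<le> a0 \<Longrightarrow> lam * a \<le> 1 \<Longrightarrow>
      N (z + a *\<^sub>R (h (z + y) - A *v y) - xs) \<le> (1 - a * (lam / 4)) * N (z - xs) + a * (lam / 4) * \<delta>"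
    using local_contraction[OF lam K a0 Nadd nN NK NA h h0] by blast
  have D: "open D" "xs \<in> D" "V xs = 0" and Vpos: "\<And>x. x \<in> D \<Longrightarrow> 0 \<le> V x"
    using L unfolding liapunov_function_def by (fastforce dest: order_less_imp_le)+
  obtain \<rho>2 where \<rho>2: "0 < \<rho>2" "\<And>x. norm (x - xs) \<le> \<rho>2 \<Longrightarrow> x \<in> sublevel D V r"
  proof -
    have "continuous (at xs) V"
      using L D unfolding liapunov_function_def gderiv_def
      by (blast intro: has_derivative_continuous)
    then have "(V \<longlongrightarrow> V xs) (nhds xs)"
      by (simp add: continuous_at tendsto_at_iff_tendsto_nhds)
    then have "\<forall>\<^sub>F x in nhds xs. V x < r"
      by (rule order_tendstoD(2)) (use D r in simp)
    moreover have "\<forall>\<^sub>F x in nhds xs. x \<in> D" using D by (simp add: eventually_nhds_in_open)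
    ultimately have "\<forall>\<^sub>F x in nhds xs. x \<in> sublevel D V r"
      by eventually_elim (simp add: sublevel_def)
    then obtain e where e: "0 < e" "\<And>x. dist x xs < e \<Longrightarrow> x \<in> sublevel D V r"
      by (auto simp: eventually_nhds_metric)
    show ?thesis by (rule that[of "e/2"]) (use e in \<open>auto simp: dist_norm\<close>)
  qed
  define \<rho> where "\<rho> = min (min \<rho>1 (\<rho>2 / 2)) (1/2)"
  have \<rho>: "0 < \<rho>" "\<rho> \<le> \<rho>1" "2 * \<rho> \<le> \<rho>2" "\<rho> \<le> 1/2" using \<rho>1 \<rho>2 by (auto simp: \<rho>_def)
  \<comment> \<open>Outside the ball \<open>N (z - xs) \<le> \<rho>\<close> the Euclidean distance is at least \<open>\<rho> / K\<close>.\<close>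
  have "0 < \<rho> / K" using \<rho> K by simp
  from liapunov_drift[OF L cpt hc this]
  obtain \<gamma> \<sigma>1 where \<gamma>: "0 < \<gamma>" and \<sigma>1: "0 < \<sigma>1" and drift:
    "\<And>z y a. z \<in> sublevel D V r \<Longrightarrow> \<rho> / K \<le> norm (z - xs) \<Longrightarrow> norm y \<le> \<sigma>1 \<Longrightarrow> 0 \<le> a \<Longrightarrow> a \<le> \<sigma>1 \<Longrightarrow>
      z + a *\<^sub>R (h (z + y) - A *v y) \<in> D \<and> V (z + a *\<^sub>R (h (z + y) - A *v y)) \<le> V z - a * \<gamma>"
    by blast
  define \<sigma> where "\<sigma> = min (min \<sigma>1 a0) (1 / lam)"
  have \<sigma>: "0 < \<sigma>" "\<sigma> \<le> \<sigma>1" "\<sigma> \<le> a0" "\<sigma> \<le> 1 / lam" using \<sigma>1 a0 lam by (auto simp: \<sigma>_def)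
  define T1 where "T1 = r / \<gamma>"
  have main: "norm (x n - xs) \<le> 2 * \<delta> + \<rho> * exp (- (lam / 4) * (time_grid a n - T1))"
    if r0: "r0 \<le> r" and \<delta>: "\<delta> \<le> \<rho>" "\<delta> \<le> \<sigma>" and a: "\<And>n. 0 < a n" "\<And>n. a n \<le> \<sigma>"
      and nb: "nbhd \<delta> (sublevel D V r0) \<subseteq> sublevel D V r" and Y: "\<And>n. norm (Y n) \<le> \<delta>"
      and x0: "x 0 - Y 0 \<in> sublevel D V r0"
      and rec: "\<And>n. x n \<in> sublevel D V r \<Longrightarrow>
         x (Suc n) - Y (Suc n) = (x n - Y n) + a n *\<^sub>R (h (x n) - A *v Y n)"
      and n: "T1 < time_grid a n"
    for r0 \<delta> a n and x Y :: "nat \<Rightarrow> real^'n"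
  proof -
    define z where "z n = x n - Y n" for n
    define t where "t = time_grid a"
    have t: "t 0 = 0" "t (Suc n) = t n + a n" for n by (simp_all add: t_def time_grid_def)
    have \<delta>0: "0 \<le> \<delta>" using Y[of 0] norm_ge_zero[of "Y 0"] by linarith
    define out where "out n \<longleftrightarrow> z n \<in> sublevel D V r0 \<and> \<rho> < N (z n - xs) \<and> V (z n) \<le> r0 - t n * \<gamma>" for n
    define ins where "ins n \<longleftrightarrow> N (z n - xs) \<le> \<rho> \<and>
      N (z n - xs) \<le> \<delta> + \<rho> * exp (- (lam / 4) * (t n - T1))" for n
    have early: "t n \<le> T1" if "z n \<in> D" "V (z n) \<le> r0 - t n * \<gamma>" for n
    proof -
      have "t n * \<gamma> \<le> r" using that Vpos[of "z n"] r0 by linarith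
      then show ?thesis using \<gamma> by (simp add: T1_def field_simps)
    qed
    have enter: "out n \<or> ins n" if "z n \<in> sublevel D V r0" "V (z n) \<le> r0 - t n * \<gamma>" for n
    proof (cases "\<rho> < N (z n - xs)")
      case True
      then show ?thesis using that by (simp add: out_def)
    next
      case False
      have "t n \<le> T1" using that by (intro early) (auto simp: sublevel_def)
      then have "(lam / 4) * (t n - T1) \<le> 0" using lam by (intro mult_nonneg_nonpos) auto
      then have "1 \<le> exp (- (lam / 4) * (t n - T1))" by simp
      then have "\<rho> * 1 \<le> \<rho> * exp (- (lam / 4) * (t n - T1))" using \<rho> by (intro mult_left_mono) auto
      then show ?thesis using False \<delta>0 by (simp add: ins_def)
    qed
    have "out n \<or> ins n" for n
    proof (induction n)
      case 0
      show ?case using x0 by (intro enter) (auto simp: z_def t sublevel_def)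
    next
      case (Suc n)
      have xz: "x n = z n + Y n" by (simp add: z_def)
      have an: "0 \<le> a n" "a n \<le> \<sigma>1" "a n \<le> a0" "lam * a n \<le> 1"
      proof -
        show "0 \<le> a n" "a n \<le> \<sigma>1" "a n \<le> a0" using a[of n] \<sigma> by auto
        have "lam * a n \<le> lam * (1 / lam)" using a(2)[of n] \<sigma>(4) lam by (intro mult_left_mono) auto
        then show "lam * a n \<le> 1" using lam by simp
      qed
      from Suc show ?case
      proof
        assume o: "out n"
        then have z0: "z n \<in> sublevel D V r0" by (simp add: out_def)
        have "x n \<in> nbhd \<delta> (sublevel D V r0)"
          using z0 Y[of n] by (auto simp: nbhd_def xz intro!: bexI[of _ "z n"])
        then have zS: "z (Suc n) = z n + a n *\<^sub>R (h (z n + Y n) - A *v Y n)"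
          using rec[of n] nb by (auto simp: z_def)
        have "\<rho> / K \<le> norm (z n - xs)"
          using o NK[of "z n - xs"] K by (simp add: out_def field_simps)
        moreover have "z n \<in> sublevel D V r" using z0 r0 by (auto simp: sublevel_def)
        moreover have "norm (Y n) \<le> \<sigma>1" using Y[of n] \<delta> \<sigma> by linarith
        ultimately have "z (Suc n) \<in> D \<and> V (z (Suc n)) \<le> V (z n) - a n * \<gamma>"
          unfolding zS using an by (intro drift)
        moreover have "0 \<le> a n * \<gamma>" using an \<gamma> by simp
        ultimately show ?thesis
          using o by (intro enter) (auto simp: out_def sublevel_def t distrib_right)
      next
        assume i: "ins n"
        have "norm (x n - xs) \<le> norm (z n - xs) + norm (Y n)"
          unfolding xz using norm_triangle_ineq[of "z n - xs" "Y n"] by (simp add: algebra_simps)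
        also have "\<dots> \<le> \<rho>2" using i nN[of "z n - xs"] Y[of n] \<delta> \<rho> by (simp add: ins_def)
        finally have zS: "z (Suc n) = z n + a n *\<^sub>R (h (z n + Y n) - A *v Y n)"
          using rec[of n] \<rho>2(2) by (auto simp: z_def)
        define v where "v = a n * (lam / 4)"
        have "v = lam * a n / 4" by (simp add: v_def)
        moreover have "0 \<le> lam * a n" using an lam by simp
        ultimately have v: "0 \<le> v" "v \<le> 1" using an(4) by linarith+
        have N1: "N (z (Suc n) - xs) \<le> (1 - v) * N (z n - xs) + v * \<delta>"
          unfolding zS v_def using i \<rho> \<delta> Y[of n] an by (intro contr) (auto simp: ins_def)
        also have "\<dots> \<le> (1 - v) * \<rho> + v * \<rho>"
          using i \<delta> v by (intro add_mono mult_left_mono) (auto simp: ins_def)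
        finally have 1: "N (z (Suc n) - xs) \<le> \<rho>" by (simp add: algebra_simps)
        have "(1 - v) * N (z n - xs) \<le> (1 - v) * (\<delta> + \<rho> * exp (- (lam / 4) * (t n - T1)))"
          using i v by (intro mult_left_mono) (auto simp: ins_def)
        with N1 have "N (z (Suc n) - xs) \<le> \<delta> + (1 - v) * (\<rho> * exp (- (lam / 4) * (t n - T1)))"
          by (simp add: algebra_simps)
        also have "(1 - v) * (\<rho> * exp (- (lam / 4) * (t n - T1)))
            \<le> exp (- v) * (\<rho> * exp (- (lam / 4) * (t n - T1)))"
          using exp_ge_add_one_self[of "- v"] \<rho> by (intro mult_right_mono) auto
        also have "\<dots> = \<rho> * (exp (- v) * exp (- (lam / 4) * (t n - T1)))" by simp
        also have "exp (- v) * exp (- (lam / 4) * (t n - T1)) = exp (- (lam / 4) * (t (Suc n) - T1))"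
        proof -
          have "- (p * l) + - l * (q - T) = - l * (q + p - T)" for p l q T :: real
            by (simp add: algebra_simps)
          from this[of "a n" "lam / 4" "t n" T1] show ?thesis
            unfolding exp_add[symmetric] t v_def by simp
        qed
        finally show ?thesis using 1 by (simp add: ins_def)
      qed
    qed
    moreover have "\<not> out n"
      using early[of n] n by (auto simp: out_def sublevel_def t_def)
    ultimately have i: "ins n" by blast
    have "norm (x n - xs) \<le> norm (z n - xs) + norm (Y n)"
      unfolding z_def using norm_triangle_ineq[of "x n - Y n - xs" "Y n"] by (simp add: algebra_simps)
    then show ?thesis
      using i nN[of "z n - xs"] Y[of n] unfolding ins_def t_def by linarith
  qed
  have "0 \<le> T1" using r \<gamma> by (simp add: T1_def)
  moreover have "euler_trapping h A D V xs r lam \<rho> \<sigma> T1"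
    unfolding euler_trapping_def
  proof (intro allI impI, goal_cases)
    case (1 r0 \<delta> a x Y n)
    then show ?case by (intro main[where ?r0.0 = r0 and Y = Y]) auto
  qed
  ultimately show ?thesis by (intro that[OF \<rho>(1,4) \<sigma>(1)])
qed

section \<open>Concentration of the filtered noise\<close>

text \<open>
  These two bounds are the form in which \<open>beta\<close> enters the induction on \<open>n\<close>: one more step damps
  the old weights by \<open>exp (- lam * a n)\<close> and adds the new weight \<open>a n\<close>.
\<close>
lemma beta_Suc_ge:
  assumes "\<And>n. 0 < a n"
  shows "a n \<le> beta lam a (Suc n)" "exp (- lam * a n) * beta lam a n \<le> beta lam a (Suc n)"
proof -
  let ?w = "\<lambda>n k. exp (- lam * (\<Sum>i\<in>{k+1..<n}. a i)) * a k"
  have ge: "?w (Suc n) k \<le> beta lam a (Suc n)" if "k \<le> n" for k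
    using that unfolding beta_def by (auto intro!: Max_ge)
  show an: "a n \<le> beta lam a (Suc n)" using ge[of n] by simp
  show "exp (- lam * a n) * beta lam a n \<le> beta lam a (Suc n)"
  proof (cases "n = 0")
    case True
    then show ?thesis using an assms[of n] by (simp add: beta_def)
  next
    case False
    then have "beta lam a n \<in> ?w n ` {0..<n}"
      unfolding beta_def by (auto intro!: Max_in)
    then obtain k where k: "k < n" "beta lam a n = ?w n k" by auto
    have "(\<Sum>i\<in>{k+1..<Suc n}. a i) = (\<Sum>i\<in>{k+1..<n}. a i) + a n" using k by simp
    then have "exp (- lam * a n) * beta lam a n = ?w (Suc n) k"
      unfolding k(2) \<open>sum a {k+1..<Suc n} = _\<close> distrib_left exp_add by (simp only: mult_ac)
    then show ?thesis using ge[OF less_imp_le[OF k(1)]] by (simp only:)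
  qed
qed

lemma beta_nonneg:
  assumes "\<And>n. 0 < a n" shows "0 \<le> beta lam a n"
proof (cases n)
  case (Suc m)
  then show ?thesis using beta_Suc_ge(1)[of a m lam] assms[of m] assms by fastforce
qed (simp add: beta_def)

text \<open>
  The noise \<open>Y\<close>, driven by the increments that are received while the iterate is in \<open>S\<close>. The indicator depends
  on the present iterate only, so it is known before the increment is drawn and the martingale
  property survives the truncation.
\<close>
primrec damped_noise ::
  "real^'n^'n \<Rightarrow> (real^'n) set \<Rightarrow> (real^'n \<Rightarrow> real^'n) \<Rightarrow> (nat \<Rightarrow> real) \<Rightarrow> ('w \<Rightarrow> real^'n) \<Rightarrow>
   (nat \<Rightarrow> 'w \<Rightarrow> real^'n) \<Rightarrow> nat \<Rightarrow> 'w \<Rightarrow> real^'n"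
where
  "damped_noise A S h a x0 M 0 \<omega> = 0"
| "damped_noise A S h a x0 M (Suc n) \<omega> =
     damped_noise A S h a x0 M n \<omega> + a n *\<^sub>R (A *v damped_noise A S h a x0 M n \<omega>)
     + a n *\<^sub>R (indicat_real S (iterate h a x0 M n \<omega>) *\<^sub>R M (Suc n) \<omega>)"

text \<open>
  The value of the layer sum that bounds the conditional expectation of \<open>exp (b2 / 2 * norm m)\<close>
  for an increment \<open>m\<close> with \<open>P(norm m > u) \<le> b1 * exp (- b2 * u)\<close> for all \<open>u \<ge> uL\<close>.
\<close>
definition moment_const :: "real \<Rightarrow> real \<Rightarrow> real \<Rightarrow> real" where
  "moment_const b1 b2 uL =
     exp (b2 / 2 * max uL 0) + b1 * exp (b2 / 2) * exp (- (b2 / 2) * max uL 0) / (1 - exp (- (b2 / 2)))"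

lemma moment_const_pos:
  assumes "0 \<le> b1" "0 < b2" shows "0 < moment_const b1 b2 uL"
  unfolding moment_const_def using assms by (intro add_pos_nonneg divide_nonneg_nonneg) auto

locale tailed_noise = prob_space P
  for P :: "'w measure" +
  fixes h :: "real^'n \<Rightarrow> real^'n" and a :: "nat \<Rightarrow> real" and x0 :: "'w \<Rightarrow> real^'n"
    and M :: "nat \<Rightarrow> 'w \<Rightarrow> real^'n" and c1 c2 :: "real^'n \<Rightarrow> real" and uL b1 b2 :: real
    and S :: "(real^'n) set"
  assumes h_cont: "continuous_on UNIV h"
    and x0_meas: "x0 \<in> borel_measurable P"
    and mart: "martingale_difference P x0 M"
    and tails: "exponential_tails P h a x0 M c1 c2 uL"
    and S_meas: "S \<in> sets borel"
    and b1: "\<And>x. x \<in> S \<Longrightarrow> c1 x \<le> b1" "0 \<le> b1"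
    and b2: "\<And>x. x \<in> S \<Longrightarrow> b2 \<le> c2 x" "0 < b2"
begin

abbreviation "\<F> \<equiv> noise_filtration P x0 M"
abbreviation "X \<equiv> iterate h a x0 M"
abbreviation "Y A \<equiv> damped_noise A S h a x0 M"

definition kept :: "nat \<Rightarrow> 'w \<Rightarrow> real^'n" where
  "kept n \<omega> = indicat_real S (X n \<omega>) *\<^sub>R M (Suc n) \<omega>"

lemma M_integrable: "integrable P (M (Suc n))"
  using mart by (simp add: martingale_difference_def)

lemma M_meas: "1 \<le> k \<Longrightarrow> M k \<in> borel_measurable P"
  using borel_measurable_integrable[OF M_integrable[of "k - 1"]] by simp

lemma gens_subset: "{x0 -` B \<inter> space P | B. B \<in> sets borel} \<union>
        {M k -` B \<inter> space P | k B. 1 \<le> k \<and> k \<le> n \<and> B \<in> sets borel} \<subseteq> sets P"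
  using measurable_sets[OF x0_meas] measurable_sets[OF M_meas] by auto

lemma space_filtration: "space (\<F> n) = space P"
  unfolding noise_filtration_def by (rule space_measure_of) (use gens_subset sets.sets_into_space in blast)

lemma sets_filtration: "sets (\<F> n) = sigma_sets (space P) ({x0 -` B \<inter> space P | B. B \<in> sets borel} \<union>
        {M k -` B \<inter> space P | k B. 1 \<le> k \<and> k \<le> n \<and> B \<in> sets borel})"
  unfolding noise_filtration_def by (rule sets_measure_of) (use gens_subset sets.sets_into_space in blast)

lemma subalg: "subalgebra P (\<F> n)"
  unfolding subalgebra_def space_filtration sets_filtration
  using sets.sigma_sets_subset[OF gens_subset] by blast

lemma cond: "sigma_finite_subalgebra P (\<F> n)"
  by (rule finite_measure_subalgebra_is_sigma_finite)
     (simp add: finite_measure_subalgebra_def finite_measure_subalgebra_axioms_def subalg finite_measure_axioms)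

lemma x0_filtration: "x0 \<in> borel_measurable (\<F> n)"
  by (rule measurableI) (auto simp: space_filtration sets_filtration intro!: sigma_sets.Basic)

lemma M_filtration: "1 \<le> k \<Longrightarrow> k \<le> n \<Longrightarrow> M k \<in> borel_measurable (\<F> n)"
  by (rule measurableI) (auto simp: space_filtration sets_filtration intro!: sigma_sets.Basic)

lemma X_filtration: "m \<le> n \<Longrightarrow> X m \<in> borel_measurable (\<F> n)"
proof (induction m)
  case 0
  then show ?case using x0_filtration by (simp add: fun_eq_iff[symmetric] cong: measurable_cong)
next
  case (Suc m)
  then have [measurable]: "X m \<in> borel_measurable (\<F> n)" by simp
  have [measurable]: "M (Suc m) \<in> borel_measurable (\<F> n)" using M_filtration Suc by simp
  have [measurable]: "h \<in> borel_measurable borel" using h_cont by (rule borel_measurable_continuous_onI)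
  show ?case by simp
qed

lemma kept_filtration: "m < n \<Longrightarrow> kept m \<in> borel_measurable (\<F> n)"
proof -
  assume "m < n"
  then have [measurable]: "X m \<in> borel_measurable (\<F> n)" "M (Suc m) \<in> borel_measurable (\<F> n)"
    using X_filtration M_filtration by auto
  note S_meas[measurable]
  show ?thesis unfolding kept_def by measurable
qed

lemma Y_Suc: "Y A (Suc n) \<omega> = Y A n \<omega> + a n *\<^sub>R (A *v Y A n \<omega>) + a n *\<^sub>R kept n \<omega>"
  by (simp add: kept_def)

lemma mat_measurable: "(\<lambda>v. B *v v) \<in> borel_measurable borel" for B :: "real^'n^'n"
  by (intro borel_measurable_continuous_onI linear_continuous_on matrix_vector_mul_bounded_linear)

lemma Y_filtration: "m \<le> n \<Longrightarrow> Y A m \<in> borel_measurable (\<F> n)"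
proof (induction m)
  case 0
  then show ?case by simp
next
  case (Suc m)
  then have [measurable]: "Y A m \<in> borel_measurable (\<F> n)" by simp
  have [measurable]: "kept m \<in> borel_measurable (\<F> n)" using kept_filtration Suc by simp
  note mat_measurable[of A, measurable]
  show ?case unfolding Y_Suc by measurable
qed

lemma from_filtration: "f \<in> borel_measurable (\<F> n) \<Longrightarrow> f \<in> borel_measurable P"
  by (rule measurable_from_subalg[OF subalg])

lemma X_meas [measurable]: "X n \<in> borel_measurable P"
  using X_filtration from_filtration by blast

lemma Y_meas [measurable]: "Y A n \<in> borel_measurable P"
  using Y_filtration from_filtration by blast

lemma kept_meas [measurable]: "kept n \<in> borel_measurable P"
  using kept_filtration[of n "Suc n"] from_filtration by blast

text \<open>
  Conditional statements are used in integrated form, tested against nonnegative weights \<open>W\<close> that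
  are measurable with respect to the past.
\<close>
lemma tail_weighted:
  assumes W: "W \<in> borel_measurable (\<F> n)" "\<And>\<omega>. 0 \<le> W \<omega>" "integrable P W"
    and u: "uL \<le> u" "0 \<le> u"
  shows "(\<integral>\<omega>. W \<omega> * indicator {\<omega> \<in> space P. u < norm (kept n \<omega>)} \<omega> \<partial>P)
     \<le> b1 * exp (- b2 * u) * (\<integral>\<omega>. W \<omega> \<partial>P)"
proof -
  interpret sigma_finite_subalgebra P "\<F> n" by (rule cond)
  define I :: "'w \<Rightarrow> real" where "I = indicator {\<omega> \<in> space P. u < norm (M (Suc n) \<omega>)}"
  define W' where "W' \<omega> = W \<omega> * indicat_real S (X n \<omega>)" for \<omega>
  have [measurable]: "M (Suc n) \<in> borel_measurable P" by (rule M_meas) simp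
  have [measurable]: "W \<in> borel_measurable P" using W(1) by (rule from_filtration)
  have [measurable]: "I \<in> borel_measurable P" unfolding I_def by measurable
  have W'F: "W' \<in> borel_measurable (\<F> n)"
    using W(1) X_filtration[of n n] S_meas unfolding W'_def by measurable
  then have [measurable]: "W' \<in> borel_measurable P" by (rule from_filtration)
  have W'0: "0 \<le> W' \<omega>" and W'W: "W' \<omega> \<le> W \<omega>" for \<omega> using W(2)[of \<omega>] by (auto simp: W'_def indicator_def)
  have iW': "integrable P W'"
    by (rule Bochner_Integration.integrable_bound[OF W(3)]) (use W'0 W'W W(2) in auto)
  have iWI: "integrable P (\<lambda>\<omega>. W' \<omega> * I \<omega>)"
    by (rule Bochner_Integration.integrable_bound[OF iW']) (auto simp: I_def indicator_def)
  have "(\<integral>\<omega>. W \<omega> * indicator {\<omega> \<in> space P. u < norm (kept n \<omega>)} \<omega> \<partial>P) = (\<integral>\<omega>. W' \<omega> * I \<omega> \<partial>P)"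
    by (rule Bochner_Integration.integral_cong[OF refl]) (use u in \<open>auto simp: W'_def I_def kept_def indicator_def\<close>)
  also have "\<dots> = (\<integral>\<omega>. W' \<omega> * real_cond_exp P (\<F> n) I \<omega> \<partial>P)"
    by (rule real_cond_exp_intg(2)[symmetric]) (use iWI W'F in auto)
  also have "\<dots> \<le> (\<integral>\<omega>. W' \<omega> * (b1 * exp (- b2 * u)) \<partial>P)"
  proof (rule integral_mono_AE)
    show "integrable P (\<lambda>\<omega>. W' \<omega> * real_cond_exp P (\<F> n) I \<omega>)"
      by (rule real_cond_exp_intg(1)) (use iWI W'F in auto)
    show "integrable P (\<lambda>\<omega>. W' \<omega> * (b1 * exp (- b2 * u)))" using iW' by simp
    have "AE \<omega> in P. real_cond_exp P (\<F> n) I \<omega> \<le> c1 (X n \<omega>) * exp (- c2 (X n \<omega>) * u)"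
      using tails u(1) unfolding exponential_tails_def I_def by blast
    then show "AE \<omega> in P. W' \<omega> * real_cond_exp P (\<F> n) I \<omega> \<le> W' \<omega> * (b1 * exp (- b2 * u))"
    proof eventually_elim
      case (elim \<omega>)
      show ?case
      proof (cases "X n \<omega> \<in> S")
        case True
        have "c1 (X n \<omega>) * exp (- c2 (X n \<omega>) * u) \<le> b1 * exp (- b2 * u)"
          using b1(1)[OF True] b1(2) b2(1)[OF True] u by (intro mult_mono) (auto intro: mult_right_mono)
        with elim show ?thesis by (intro mult_left_mono W'0) linarith
      qed (simp add: W'_def)
    qed
  qed
  also have "\<dots> = b1 * exp (- b2 * u) * (\<integral>\<omega>. W' \<omega> \<partial>P)" by simp
  also have "\<dots> \<le> b1 * exp (- b2 * u) * (\<integral>\<omega>. W \<omega> \<partial>P)"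
    using b1(2) by (intro mult_left_mono integral_mono iW' W(3) W'W) auto
  finally show ?thesis .
qed

text \<open>
  Layers of width one above \<open>max uL 0\<close>: on the layer with index \<open>j\<close> the exponential is at most its value at the
  upper end, while the tail bound at the lower end decays twice as fast, so the series is geometric.
\<close>
lemma exp_moment:
  assumes W: "W \<in> borel_measurable (\<F> n)" "\<And>\<omega>. 0 \<le> W \<omega>" "integrable P W"
  shows "integrable P (\<lambda>\<omega>. W \<omega> * exp (b2 / 2 * norm (kept n \<omega>)))" (is ?th1)
    and "(\<integral>\<omega>. W \<omega> * exp (b2 / 2 * norm (kept n \<omega>)) \<partial>P) \<le> moment_const b1 b2 uL * (\<integral>\<omega>. W \<omega> \<partial>P)" (is ?th2)
proof -
  define s where "s = b2 / 2"
  have s: "0 < s" using b2 by (simp add: s_def)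
  define u0 where "u0 = max uL 0"
  define G where "G = moment_const b1 b2 uL"
  have G0: "0 < G" unfolding G_def by (rule moment_const_pos) (use b1 b2 in auto)
  define I :: "nat \<Rightarrow> 'w \<Rightarrow> real" where "I j = indicator {\<omega> \<in> space P. u0 + j < norm (kept n \<omega>)}" for j
  have [measurable]: "W \<in> borel_measurable P" using W(1) by (rule from_filtration)
  have [measurable]: "I j \<in> borel_measurable P" for j unfolding I_def by measurable
  have W0: "0 \<le> (\<integral>\<omega>. W \<omega> \<partial>P)" using W(2) by simp
  define E where "E j = exp (s * (u0 + j + 1))" for j :: nat
  define q where "q = exp (- s)"
  have q: "0 < q" "q < 1" using s by (auto simp: q_def)
  have layer: "ennreal (exp (s * norm (kept n \<omega>))) \<le> ennreal (exp (s * u0)) + (\<Sum>j. ennreal (E j * I j \<omega>))"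
    if \<omega>: "\<omega> \<in> space P" for \<omega>
  proof (cases "norm (kept n \<omega>) \<le> u0")
    case True
    then have "ennreal (exp (s * norm (kept n \<omega>))) \<le> ennreal (exp (s * u0))"
      using s by (intro ennreal_leI) simp
    then show ?thesis by (simp add: add_increasing2)
  next
    case False
    define j where "j = nat (\<lceil>norm (kept n \<omega>) - u0\<rceil> - 1)"
    have "0 < \<lceil>norm (kept n \<omega>) - u0\<rceil>" using False by simp
    then have "real j = of_int \<lceil>norm (kept n \<omega>) - u0\<rceil> - 1" by (simp add: j_def)
    then have j: "u0 + j < norm (kept n \<omega>)" "norm (kept n \<omega>) \<le> u0 + j + 1" by linarith+
    have "ennreal (exp (s * norm (kept n \<omega>))) \<le> ennreal (E j * I j \<omega>)"
      using j s \<omega> by (intro ennreal_leI) (simp add: E_def I_def)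
    also have "\<dots> = (\<Sum>i\<in>{j}. ennreal (E i * I i \<omega>))" by simp
    also have "\<dots> \<le> (\<Sum>j. ennreal (E j * I j \<omega>))"
      by (rule sum_le_suminf) auto
    finally show ?thesis by (simp add: add_increasing)
  qed
  have int_I: "(\<integral>\<^sup>+\<omega>. ennreal (W \<omega> * (E j * I j \<omega>)) \<partial>P)
      \<le> ennreal (b1 * exp s * exp (- s * u0) * (\<integral>\<omega>. W \<omega> \<partial>P) * q ^ j)" for j
  proof -
    have WI0: "0 \<le> W \<omega> * I j \<omega>" for \<omega> using W(2) by (simp add: I_def)
    have i: "integrable P (\<lambda>\<omega>. W \<omega> * I j \<omega>)"
      by (rule Bochner_Integration.integrable_bound[OF W(3)]) (auto simp: I_def indicator_def)
    have "(\<integral>\<^sup>+\<omega>. ennreal (W \<omega> * (E j * I j \<omega>)) \<partial>P) = (\<integral>\<^sup>+\<omega>. ennreal (E j * (W \<omega> * I j \<omega>)) \<partial>P)"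
      by (simp add: mult_ac)
    also have "\<dots> = ennreal (\<integral>\<omega>. E j * (W \<omega> * I j \<omega>) \<partial>P)"
      by (rule nn_integral_eq_integral) (use i WI0 in \<open>auto simp: E_def\<close>)
    also have "\<dots> = ennreal (E j * (\<integral>\<omega>. W \<omega> * I j \<omega> \<partial>P))" by simp
    also have "\<dots> \<le> ennreal (E j * (b1 * exp (- b2 * (u0 + j)) * (\<integral>\<omega>. W \<omega> \<partial>P)))"
      unfolding I_def by (intro ennreal_leI mult_left_mono tail_weighted W) (auto simp: u0_def E_def)
    also have "E j * (b1 * exp (- b2 * (u0 + j)) * (\<integral>\<omega>. W \<omega> \<partial>P))
       = b1 * (E j * exp (- b2 * (u0 + j))) * (\<integral>\<omega>. W \<omega> \<partial>P)" by simp
    also have "E j * exp (- b2 * (u0 + j)) = exp s * exp (- s * u0) * q ^ j"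
    proof -
      have "q ^ j = exp (real j * - s)" unfolding q_def by (rule exp_of_nat_mult[symmetric])
      then show ?thesis unfolding E_def exp_add[symmetric] by (simp add: s_def field_simps flip: exp_add)
    qed
    finally show ?thesis by (simp add: mult_ac)
  qed
  have "(\<integral>\<^sup>+\<omega>. ennreal (W \<omega> * exp (s * norm (kept n \<omega>))) \<partial>P)
     \<le> (\<integral>\<^sup>+\<omega>. ennreal (exp (s * u0) * W \<omega>) + (\<Sum>j. ennreal (W \<omega> * (E j * I j \<omega>))) \<partial>P)"
  proof (rule nn_integral_mono)
    fix \<omega> assume \<omega>: "\<omega> \<in> space P"
    have "ennreal (W \<omega> * exp (s * norm (kept n \<omega>))) = ennreal (W \<omega>) * ennreal (exp (s * norm (kept n \<omega>)))"
      using W(2) by (simp add: ennreal_mult)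
    also have "\<dots> \<le> ennreal (W \<omega>) * (ennreal (exp (s * u0)) + (\<Sum>j. ennreal (E j * I j \<omega>)))"
      by (intro mult_left_mono layer \<omega>) simp
    also have "\<dots> = ennreal (exp (s * u0) * W \<omega>) + (\<Sum>j. ennreal (W \<omega> * (E j * I j \<omega>)))"
    proof -
      have "ennreal (W \<omega>) * (\<Sum>j. ennreal (E j * I j \<omega>)) = (\<Sum>j. ennreal (W \<omega>) * ennreal (E j * I j \<omega>))"
        by (rule ennreal_suminf_cmult[symmetric])
      also have "\<dots> = (\<Sum>j. ennreal (W \<omega> * (E j * I j \<omega>)))"
        using W(2) by (intro suminf_cong ennreal_mult'[symmetric]) auto
      finally have "ennreal (W \<omega>) * (\<Sum>j. ennreal (E j * I j \<omega>)) = (\<Sum>j. ennreal (W \<omega> * (E j * I j \<omega>)))" .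
      moreover have "ennreal (W \<omega>) * ennreal (exp (s * u0)) = ennreal (exp (s * u0) * W \<omega>)"
        using W(2) by (simp add: ennreal_mult' mult.commute[of "ennreal (W \<omega>)"])
      ultimately show ?thesis by (simp only: distrib_left)
    qed
    finally show "ennreal (W \<omega> * exp (s * norm (kept n \<omega>)))
      \<le> ennreal (exp (s * u0) * W \<omega>) + (\<Sum>j. ennreal (W \<omega> * (E j * I j \<omega>)))" .
  qed
  also have "\<dots> = (\<integral>\<^sup>+\<omega>. ennreal (exp (s * u0) * W \<omega>) \<partial>P) + (\<Sum>j. \<integral>\<^sup>+\<omega>. ennreal (W \<omega> * (E j * I j \<omega>)) \<partial>P)"
    by (subst nn_integral_add) (auto intro!: nn_integral_suminf)
  also have "(\<integral>\<^sup>+\<omega>. ennreal (exp (s * u0) * W \<omega>) \<partial>P) = ennreal (exp (s * u0) * (\<integral>\<omega>. W \<omega> \<partial>P))"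
    using W by (subst nn_integral_eq_integral) auto
  also have "(\<Sum>j. \<integral>\<^sup>+\<omega>. ennreal (W \<omega> * (E j * I j \<omega>)) \<partial>P)
     \<le> (\<Sum>j. ennreal (b1 * exp s * exp (- s * u0) * (\<integral>\<omega>. W \<omega> \<partial>P) * q ^ j))"
    by (intro suminf_le int_I) auto
  also have "\<dots> = ennreal (b1 * exp s * exp (- s * u0) * (\<integral>\<omega>. W \<omega> \<partial>P) * (1 / (1 - q)))"
  proof (rule suminf_ennreal_eq)
    show "(\<lambda>j. b1 * exp s * exp (- s * u0) * (\<integral>\<omega>. W \<omega> \<partial>P) * q ^ j) sums
        (b1 * exp s * exp (- s * u0) * (\<integral>\<omega>. W \<omega> \<partial>P) * (1 / (1 - q)))"
      by (intro sums_mult geometric_sums) (use q in simp)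
  qed (use b1 W0 q in auto)
  also have "ennreal (exp (s * u0) * (\<integral>\<omega>. W \<omega> \<partial>P)) + \<dots> = ennreal (G * (\<integral>\<omega>. W \<omega> \<partial>P))"
  proof -
    have "exp (s * u0) * (\<integral>\<omega>. W \<omega> \<partial>P) + b1 * exp s * exp (- s * u0) * (\<integral>\<omega>. W \<omega> \<partial>P) * (1 / (1 - q))
      = G * (\<integral>\<omega>. W \<omega> \<partial>P)"
      by (simp add: G_def moment_const_def s_def q_def u0_def distrib_right)
    moreover have "0 \<le> b1 * exp s * exp (- s * u0) * (\<integral>\<omega>. W \<omega> \<partial>P) * (1 / (1 - q))"
      using b1 W0 q by auto
    ultimately show ?thesis using W0 by (subst ennreal_plus[symmetric]) auto
  qed
  finally have nn: "(\<integral>\<^sup>+\<omega>. ennreal (W \<omega> * exp (s * norm (kept n \<omega>))) \<partial>P) \<le> ennreal (G * (\<integral>\<omega>. W \<omega> \<partial>P))"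
    by (simp add: add_left_mono)
  have i: "integrable P (\<lambda>\<omega>. W \<omega> * exp (s * norm (kept n \<omega>)))"
  proof (rule integrableI_nonneg)
    show "(\<integral>\<^sup>+\<omega>. ennreal (W \<omega> * exp (s * norm (kept n \<omega>))) \<partial>P) < \<infinity>"
      using nn by (rule order_le_less_trans) simp
  qed (use W in auto)
  then show ?th1 by (simp add: s_def)
  have "ennreal (\<integral>\<omega>. W \<omega> * exp (s * norm (kept n \<omega>)) \<partial>P) \<le> ennreal (G * (\<integral>\<omega>. W \<omega> \<partial>P))"
    using nn W(2) by (subst nn_integral_eq_integral[OF i, symmetric]) auto
  then show ?th2 using G0 W0 by (simp add: s_def G_def)
qed

end

lemma exp_le_quadratic: "exp y \<le> 1 + y + y\<^sup>2 / 2 * exp \<bar>y\<bar>" for y :: real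
proof -
  obtain t where t: "\<bar>t\<bar> \<le> \<bar>y\<bar>" "exp y = (\<Sum>m<2. y ^ m / fact m) + exp t / fact 2 * y ^ 2"
    using Maclaurin_exp_le[of y 2] by blast
  have "exp t * y\<^sup>2 \<le> exp \<bar>y\<bar> * y\<^sup>2" using t(1) by (intro mult_right_mono) auto
  then show ?thesis unfolding t(2) by (simp add: numeral_2_eq_2 mult.commute)
qed

lemma vec_nth_measurable [measurable]: "(\<lambda>x :: real^'n. x $ i) \<in> borel_measurable borel"
  by (intro borel_measurable_continuous_onI linear_continuous_on bounded_linear_vec_nth)

text \<open>
  The factor of \<open>q\<^sup>2\<close> in the exponent of the moment generating function of one increment: with
  \<open>s = b2 / 2\<close> it is \<open>8 / s\<^sup>2\<close> times the moment constant, where \<open>8 / s\<^sup>2\<close> is half of the constant in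
  \<open>u\<^sup>2 \<le> 16 / s\<^sup>2 * exp (s * u / 2)\<close>.
\<close>
definition var_const :: "real \<Rightarrow> real \<Rightarrow> real \<Rightarrow> real" where
  "var_const b1 b2 uL = 32 * moment_const b1 b2 uL / b2\<^sup>2"

lemma var_const_nonneg:
  assumes "0 \<le> b1" "0 < b2" shows "0 \<le> var_const b1 b2 uL"
  using moment_const_pos[OF assms, of uL] by (simp add: var_const_def)

context tailed_noise
begin

abbreviation "vc \<equiv> var_const b1 b2 uL"

text \<open>
  The martingale property holds for single coordinates, so a linear functional is expanded in the
  standard basis. Integrability of the product with the weight comes from \<open>exp_moment\<close>.
\<close>
lemma kept_centred:
  fixes W :: "'w \<Rightarrow> real"
  assumes W: "W \<in> borel_measurable (\<F> n)" "\<And>\<omega>. 0 \<le> W \<omega>" "integrable P W" and f: "linear f"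
  shows "integrable P (\<lambda>\<omega>. W \<omega> * f (kept n \<omega>))" "(\<integral>\<omega>. W \<omega> * f (kept n \<omega>) \<partial>P) = 0"
proof -
  interpret sigma_finite_subalgebra P "\<F> n" by (rule cond)
  have s: "0 < b2 / 2" using b2 by simp
  have [measurable]: "M (Suc n) \<in> borel_measurable P" by (rule M_meas) simp
  have [measurable]: "W \<in> borel_measurable P" using W(1) by (rule from_filtration)
  define W' where "W' \<omega> = W \<omega> * indicat_real S (X n \<omega>)" for \<omega>
  have W'F: "W' \<in> borel_measurable (\<F> n)"
    using W(1) X_filtration[of n n] S_meas unfolding W'_def by measurable
  have comp: "W \<omega> * kept n \<omega> $ i = W' \<omega> * M (Suc n) \<omega> $ i" for \<omega> i
    by (simp add: kept_def W'_def)
  have i: "integrable P (\<lambda>\<omega>. W \<omega> * kept n \<omega> $ i)" for i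
  proof (rule Bochner_Integration.integrable_bound)
    show "integrable P (\<lambda>\<omega>. (1 / (b2 / 2)) * (W \<omega> * exp (b2 / 2 * norm (kept n \<omega>))))"
      by (intro integrable_mult_right exp_moment W)
    show "AE \<omega> in P. norm (W \<omega> * kept n \<omega> $ i) \<le> norm ((1 / (b2 / 2)) * (W \<omega> * exp (b2 / 2 * norm (kept n \<omega>))))"
    proof (rule AE_I2)
      fix \<omega>
      have "\<bar>kept n \<omega> $ i\<bar> \<le> norm (kept n \<omega>)" by (rule component_le_norm_cart)
      also have "\<dots> \<le> 1 / (b2 / 2) * exp (b2 / 2 * norm (kept n \<omega>))"
        using exp_ge_add_one_self[of "b2 / 2 * norm (kept n \<omega>)"] s by (simp add: field_simps)
      finally have "W \<omega> * \<bar>kept n \<omega> $ i\<bar> \<le> W \<omega> * (1 / (b2 / 2) * exp (b2 / 2 * norm (kept n \<omega>)))"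
        by (intro mult_left_mono W)
      then show "norm (W \<omega> * kept n \<omega> $ i) \<le> norm ((1 / (b2 / 2)) * (W \<omega> * exp (b2 / 2 * norm (kept n \<omega>))))"
        using W(2)[of \<omega>] s by (simp add: abs_mult mult_ac)
    qed
  qed measurable
  have z: "(\<integral>\<omega>. W \<omega> * kept n \<omega> $ i \<partial>P) = 0" for i
  proof -
    have m: "integrable P (\<lambda>\<omega>. W' \<omega> * M (Suc n) \<omega> $ i)" using i[of i] by (simp add: comp)
    have mm: "(\<lambda>\<omega>. M (Suc n) \<omega> $ i) \<in> borel_measurable P" by measurable
    have "(\<integral>\<omega>. W \<omega> * kept n \<omega> $ i \<partial>P) = (\<integral>\<omega>. W' \<omega> * real_cond_exp P (\<F> n) (\<lambda>\<omega>. M (Suc n) \<omega> $ i) \<omega> \<partial>P)"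
      unfolding comp by (rule real_cond_exp_intg(2)[OF m W'F mm, symmetric])
    also have "\<dots> = (\<integral>\<omega>. 0 \<partial>P)"
    proof (rule integral_cong_AE)
      show "AE \<omega> in P. W' \<omega> * real_cond_exp P (\<F> n) (\<lambda>\<omega>. M (Suc n) \<omega> $ i) \<omega> = 0"
      proof -
        have "AE \<omega> in P. real_cond_exp P (\<F> n) (\<lambda>\<omega>. M (Suc n) \<omega> $ i) \<omega> = 0"
          using mart unfolding martingale_difference_def by blast
        then show ?thesis by eventually_elim simp
      qed
      show "(\<lambda>\<omega>. W' \<omega> * real_cond_exp P (\<F> n) (\<lambda>\<omega>. M (Suc n) \<omega> $ i) \<omega>) \<in> borel_measurable P"
        by (rule borel_measurable_integrable[OF real_cond_exp_intg(1)[OF m W'F mm]])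
    qed simp
    finally show ?thesis by simp
  qed
  have fx: "W \<omega> * f (kept n \<omega>) = (\<Sum>i\<in>UNIV. (W \<omega> * kept n \<omega> $ i) * f (axis i 1))" for \<omega>
  proof -
    have "f (kept n \<omega>) = f (\<Sum>i\<in>UNIV. (kept n \<omega> $ i) *\<^sub>R axis i 1)"
      using basis_expansion[of "kept n \<omega>"] by (simp add: scalar_mult_eq_scaleR)
    also have "\<dots> = (\<Sum>i\<in>UNIV. kept n \<omega> $ i * f (axis i 1))"
      by (simp add: linear_sum[OF f] linear_scale[OF f])
    finally show ?thesis by (simp add: sum_distrib_left mult_ac)
  qed
  show "integrable P (\<lambda>\<omega>. W \<omega> * f (kept n \<omega>))"
    unfolding fx by (intro Bochner_Integration.integrable_sum integrable_mult_left i)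
  have "(\<integral>\<omega>. W \<omega> * f (kept n \<omega>) \<partial>P) = (\<Sum>i\<in>UNIV. (\<integral>\<omega>. (W \<omega> * kept n \<omega> $ i) * f (axis i 1) \<partial>P))"
    unfolding fx by (intro Bochner_Integration.integral_sum integrable_mult_left i)
  also have "\<dots> = 0" by (simp add: z)
  finally show "(\<integral>\<omega>. W \<omega> * f (kept n \<omega>) \<partial>P) = 0" .
qed

text \<open>
  In \<open>exp y \<le> 1 + y + y\<^sup>2 / 2 * exp \<bar>y\<bar>\<close> the linear term integrates to \<open>0\<close>. As \<open>\<bar>y\<bar>\<close> uses at most half of
  the exponential moment, the other half is left to absorb the factor \<open>y\<^sup>2\<close>, which contributes the
  \<open>q\<^sup>2\<close>.
\<close>
lemma mgf_step:
  fixes W :: "'w \<Rightarrow> real"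
  assumes W: "W \<in> borel_measurable (\<F> n)" "\<And>\<omega>. 0 \<le> W \<omega>" "integrable P W" and f: "linear f"
    and q: "\<And>x. \<bar>f x\<bar> \<le> q * norm x" "0 \<le> q" "q \<le> b2 / 4"
  shows "integrable P (\<lambda>\<omega>. W \<omega> * exp (f (kept n \<omega>)))"
    and "(\<integral>\<omega>. W \<omega> * exp (f (kept n \<omega>)) \<partial>P) \<le> exp (vc * q\<^sup>2) * (\<integral>\<omega>. W \<omega> \<partial>P)"
proof -
  define s where "s = b2 / 2"
  have s: "0 < s" "q \<le> s / 2" using b2 q(3) by (auto simp: s_def)
  define G where "G = moment_const b1 b2 uL"
  define m where "m \<omega> = norm (kept n \<omega>)" for \<omega>
  have [measurable]: "W \<in> borel_measurable P" using W(1) by (rule from_filtration)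
  have [measurable]: "f \<in> borel_measurable borel"
    using f by (intro borel_measurable_continuous_onI linear_continuous_on) (simp add: linear_conv_bounded_linear)
  have H: "integrable P (\<lambda>\<omega>. W \<omega> * exp (s * m \<omega>))"
    "(\<integral>\<omega>. W \<omega> * exp (s * m \<omega>) \<partial>P) \<le> G * (\<integral>\<omega>. W \<omega> \<partial>P)"
    using exp_moment[OF W] by (simp_all add: s_def m_def G_def)
  have y: "\<bar>f (kept n \<omega>)\<bar> \<le> s / 2 * m \<omega>" for \<omega>
    using q(1)[of "kept n \<omega>"] mult_right_mono[OF s(2), of "m \<omega>"] by (simp add: m_def)
  show i: "integrable P (\<lambda>\<omega>. W \<omega> * exp (f (kept n \<omega>)))"
  proof (rule Bochner_Integration.integrable_bound[OF H(1)])
    show "AE \<omega> in P. norm (W \<omega> * exp (f (kept n \<omega>))) \<le> norm (W \<omega> * exp (s * m \<omega>))"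
    proof (rule AE_I2)
      fix \<omega>
      have "f (kept n \<omega>) \<le> s / 2 * m \<omega>" using y[of \<omega>] by simp
      also have "\<dots> \<le> s * m \<omega>" using s by (intro mult_right_mono) (auto simp: m_def)
      finally show "norm (W \<omega> * exp (f (kept n \<omega>))) \<le> norm (W \<omega> * exp (s * m \<omega>))"
        using W(2)[of \<omega>] by (simp add: abs_mult mult_left_mono)
    qed
  qed measurable
  define c where "c = 8 * q\<^sup>2 / s\<^sup>2"
  have c0: "0 \<le> c" by (simp add: c_def)
  have pw: "exp (f (kept n \<omega>)) \<le> 1 + f (kept n \<omega>) + c * exp (s * m \<omega>)" for \<omega>
  proof -
    define u where "u = s * m \<omega> / 4"
    have u: "0 \<le> u" using s by (simp add: u_def m_def)
    have "u\<^sup>2 \<le> (exp u)\<^sup>2" using exp_ge_add_one_self[of u] u by (intro power_mono) linarith+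
    also have "(exp u)\<^sup>2 = exp (s / 2 * m \<omega>)" by (simp add: power2_eq_square u_def flip: exp_add)
    finally have u2: "u\<^sup>2 \<le> exp (s / 2 * m \<omega>)" .
    have "(f (kept n \<omega>))\<^sup>2 \<le> (q * m \<omega>)\<^sup>2"
      using q(1)[of "kept n \<omega>"] by (simp add: m_def abs_le_square_iff[symmetric])
    also have "(q * m \<omega>)\<^sup>2 = 2 * c * u\<^sup>2"
      using s by (simp add: c_def u_def power_mult_distrib power_divide)
    also have "\<dots> \<le> 2 * c * exp (s / 2 * m \<omega>)" using c0 u2 by (intro mult_left_mono) auto
    finally have "(f (kept n \<omega>))\<^sup>2 / 2 \<le> c * exp (s / 2 * m \<omega>)" by simp
    then have "(f (kept n \<omega>))\<^sup>2 / 2 * exp \<bar>f (kept n \<omega>)\<bar> \<le> c * exp (s / 2 * m \<omega>) * exp (s / 2 * m \<omega>)"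
      using y[of \<omega>] c0 by (intro mult_mono) auto
    also have "\<dots> = c * exp (s * m \<omega>)"
      unfolding mult.assoc exp_add[symmetric] by simp
    finally show ?thesis using exp_le_quadratic[of "f (kept n \<omega>)"] by linarith
  qed
  note cent = kept_centred[OF W f]
  have "(\<integral>\<omega>. W \<omega> * exp (f (kept n \<omega>)) \<partial>P)
     \<le> (\<integral>\<omega>. (W \<omega> + W \<omega> * f (kept n \<omega>)) + c * (W \<omega> * exp (s * m \<omega>)) \<partial>P)"
  proof (rule integral_mono[OF i])
    show "integrable P (\<lambda>\<omega>. (W \<omega> + W \<omega> * f (kept n \<omega>)) + c * (W \<omega> * exp (s * m \<omega>)))"
      by (intro Bochner_Integration.integrable_add integrable_mult_right W(3) cent(1) H(1))
    fix \<omega>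
    show "W \<omega> * exp (f (kept n \<omega>)) \<le> (W \<omega> + W \<omega> * f (kept n \<omega>)) + c * (W \<omega> * exp (s * m \<omega>))"
      using mult_left_mono[OF pw[of \<omega>] W(2)[of \<omega>]] by (simp add: algebra_simps)
  qed
  also have "\<dots> = (\<integral>\<omega>. W \<omega> \<partial>P) + c * (\<integral>\<omega>. W \<omega> * exp (s * m \<omega>) \<partial>P)"
    using W(3) cent H(1) by simp
  also have "\<dots> \<le> (\<integral>\<omega>. W \<omega> \<partial>P) + c * (G * (\<integral>\<omega>. W \<omega> \<partial>P))"
    using H(2) c0 by (intro add_left_mono mult_left_mono)
  also have "\<dots> = (1 + vc * q\<^sup>2) * (\<integral>\<omega>. W \<omega> \<partial>P)"
    by (simp add: c_def var_const_def s_def G_def power_divide algebra_simps)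
  also have "\<dots> \<le> exp (vc * q\<^sup>2) * (\<integral>\<omega>. W \<omega> \<partial>P)"
    using W(2) exp_ge_add_one_self by (intro mult_right_mono) auto
  finally show "(\<integral>\<omega>. W \<omega> * exp (f (kept n \<omega>)) \<partial>P) \<le> exp (vc * q\<^sup>2) * (\<integral>\<omega>. W \<omega> \<partial>P)" .
qed

text \<open>
  Induction on \<open>n\<close>, for all functionals at once: \<open>f (Y\<^sub>n\<^sub>+\<^sub>1)\<close> splits into \<open>f\<close> composed with
  \<open>I + a\<^sub>n A\<close> at \<open>Y\<^sub>n\<close>, whose dual norm \<open>b\<close> is smaller by the factor \<open>e = exp (- lam * a n)\<close>, and a
  fresh increment of size \<open>q = a\<^sub>n b K\<close>. The factor \<open>L = (1 + lam) / lam\<close> bounds the sum of the weights: it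
  satisfies \<open>a + e L \<le> L\<close> for all steps \<open>a \<le> 1\<close>, and this closes the induction.
\<close>
lemma damped_noise_mgf:
  fixes N :: "real^'n \<Rightarrow> real"
  assumes lam: "0 < lam" and K: "1 \<le> K" and a0: "a0 \<le> 1"
    and NK: "\<And>x. N x \<le> K * norm x"
    and NA: "\<And>t x. 0 \<le> t \<Longrightarrow> t \<le> a0 \<Longrightarrow> N (x + t *\<^sub>R (A *v x)) \<le> exp (- lam * t) * N x"
    and a: "\<And>n. 0 < a n" "\<And>n. a n \<le> a0"
    and f: "linear f" "\<And>x. \<bar>f x\<bar> \<le> b * N x" "0 \<le> b" "b * K * beta lam a n \<le> b2 / 4"
  shows "integrable P (\<lambda>\<omega>. exp (f (Y A n \<omega>))) \<and>
     (\<integral>\<omega>. exp (f (Y A n \<omega>)) \<partial>P) \<le> exp (vc * (b * K)\<^sup>2 * ((1 + lam) / lam) * beta lam a n)"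
  using f
proof (induction n arbitrary: f b)
  case 0
  then show ?case by (simp add: linear_0 beta_def prob_space)
next
  case (Suc n)
  define \<beta> where "\<beta> = beta lam a"
  define e where "e = exp (- lam * a n)"
  define L where "L = (1 + lam) / lam"
  have L: "0 < L" using lam by (simp add: L_def)
  have \<beta>: "a n \<le> \<beta> (Suc n)" "e * \<beta> n \<le> \<beta> (Suc n)" "0 \<le> \<beta> n"
    using beta_Suc_ge[where a=a and n=n and lam=lam] beta_nonneg[where a=a and n=n and lam=lam] a by (auto simp: \<beta>_def e_def)
  have e: "0 < e" "e \<le> 1" using lam a(1)[of n] by (auto simp: e_def)
  have bK: "0 \<le> b * K" using Suc.prems(3) K by simp
  define f1 where "f1 x = f (x + a n *\<^sub>R (A *v x))" for x
  define f2 where "f2 x = f (a n *\<^sub>R x)" for x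
  have lf1: "linear f1"
  proof -
    have "linear (\<lambda>x. x + a n *\<^sub>R (A *v x))"
      by (intro linear_compose_add linear_compose_scale_right linear_ident matrix_vector_mul_linear)
    from linear_compose[OF this Suc.prems(1)] show ?thesis by (simp add: f1_def[abs_def] o_def)
  qed
  have lf2: "linear f2"
    using linear_compose_scale_right[OF Suc.prems(1), of "a n"]
    by (simp add: f2_def[abs_def] linear_scale[OF Suc.prems(1)])
  have f1b: "\<bar>f1 x\<bar> \<le> (b * e) * N x" for x
  proof -
    have "\<bar>f1 x\<bar> \<le> b * N (x + a n *\<^sub>R (A *v x))" unfolding f1_def by (rule Suc.prems(2))
    also have "\<dots> \<le> b * (e * N x)"
      using Suc.prems(3) a[of n] unfolding e_def by (intro mult_left_mono NA) auto
    finally show ?thesis by (simp add: mult.assoc)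
  qed
  define q where "q = a n * (b * K)"
  have f2b: "\<bar>f2 x\<bar> \<le> q * norm x" for x
  proof -
    have "\<bar>f x\<bar> \<le> b * (K * norm x)"
      using Suc.prems(2)[of x] mult_left_mono[OF NK[of x] Suc.prems(3)] by linarith
    then have "a n * \<bar>f x\<bar> \<le> a n * (b * (K * norm x))" using a(1)[of n] by (intro mult_left_mono) auto
    then show ?thesis
      using a(1)[of n] by (simp add: f2_def q_def linear_scale[OF Suc.prems(1)] abs_mult mult_ac)
  qed
  have q0: "0 \<le> q" using bK a(1)[of n] by (simp add: q_def)
  have "q \<le> (b * K) * \<beta> (Suc n)" using mult_left_mono[OF \<beta>(1) bK] by (simp add: q_def mult_ac)
  then have q1: "q \<le> b2 / 4" using Suc.prems(4) by (simp add: \<beta>_def)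
  have "(b * e) * K * \<beta> n \<le> (b * K) * \<beta> (Suc n)" using mult_left_mono[OF \<beta>(2) bK] by (simp add: mult_ac)
  then have "(b * e) * K * beta lam a n \<le> b2 / 4" using Suc.prems(4) by (simp add: \<beta>_def)
  then have IH: "integrable P (\<lambda>\<omega>. exp (f1 (Y A n \<omega>)))"
    "(\<integral>\<omega>. exp (f1 (Y A n \<omega>)) \<partial>P) \<le> exp (vc * (b * e * K)\<^sup>2 * L * \<beta> n)"
    using Suc.IH[of f1 "b * e"] lf1 f1b Suc.prems(3) e by (auto simp: \<beta>_def L_def)
  have f1m: "f1 \<in> borel_measurable borel"
    using lf1 by (intro borel_measurable_continuous_onI linear_continuous_on) (simp add: linear_conv_bounded_linear)
  have Wm: "(\<lambda>\<omega>. exp (f1 (Y A n \<omega>))) \<in> borel_measurable (\<F> n)"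
    using Y_filtration[of n n A] f1m by measurable
  have eq: "exp (f (Y A (Suc n) \<omega>)) = exp (f1 (Y A n \<omega>)) * exp (f2 (kept n \<omega>))" for \<omega>
    unfolding Y_Suc f1_def f2_def exp_add[symmetric] linear_add[OF Suc.prems(1)] by simp
  note step = mgf_step[OF Wm _ IH(1) lf2 f2b q0 q1]
  have "(\<integral>\<omega>. exp (f (Y A (Suc n) \<omega>)) \<partial>P) \<le> exp (vc * q\<^sup>2) * (\<integral>\<omega>. exp (f1 (Y A n \<omega>)) \<partial>P)"
    unfolding eq by (rule step(2)) simp
  also have "\<dots> \<le> exp (vc * q\<^sup>2) * exp (vc * (b * e * K)\<^sup>2 * L * \<beta> n)"
    using IH(2) by (intro mult_left_mono) auto
  also have "\<dots> = exp (vc * (b * K)\<^sup>2 * ((a n)\<^sup>2 + e\<^sup>2 * L * \<beta> n))"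
    unfolding exp_add[symmetric] by (simp add: q_def power_mult_distrib algebra_simps)
  also have "\<dots> \<le> exp (vc * (b * K)\<^sup>2 * (L * \<beta> (Suc n)))"
  proof -
    have an: "0 \<le> a n" "a n \<le> 1" using a[of n] a0 by linarith+
    have "lam * a n \<le> lam" using lam an by simp
    have "e * (1 + lam * a n) \<le> e * exp (lam * a n)"
      using exp_ge_add_one_self[of "lam * a n"] e by (intro mult_left_mono) auto
    also have "\<dots> = 1" unfolding e_def exp_add[symmetric] by simp
    finally have "e * (1 + lam * a n) \<le> 1" .
    have "e * (lam * a n) \<le> 1 - e" using \<open>e * (1 + lam * a n) \<le> 1\<close> by (simp add: algebra_simps)
    have "a n * lam \<le> (1 - e) * (1 + lam)"
    proof -
      have "1 - e \<ge> lam * a n / (1 + lam * a n)"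
      proof -
        have p: "0 < 1 + lam * a n" using lam an by (simp add: add_pos_nonneg)
        then have "e \<le> 1 / (1 + lam * a n)"
          using \<open>e * (1 + lam * a n) \<le> 1\<close> by (subst pos_le_divide_eq) auto
        moreover have "lam * a n / (1 + lam * a n) = 1 - 1 / (1 + lam * a n)"
          using p by (simp add: field_simps)
        ultimately show ?thesis by linarith
      qed
      moreover have "lam * a n / (1 + lam) \<le> lam * a n / (1 + lam * a n)"
        using lam an \<open>lam * a n \<le> lam\<close> by (intro divide_left_mono) (auto simp: add_pos_nonneg)
      ultimately have "lam * a n / (1 + lam) \<le> 1 - e" by linarith
      then show ?thesis using lam by (simp add: field_simps)
    qed
    then have "a n \<le> (1 - e) * L" using lam by (simp add: L_def field_simps)
    then have aL: "a n + e * L \<le> L" by (simp add: algebra_simps)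
    have "(a n)\<^sup>2 + e\<^sup>2 * L * \<beta> n = a n * a n + (e * L) * (e * \<beta> n)"
      by (simp add: power2_eq_square)
    also have "\<dots> \<le> a n * \<beta> (Suc n) + (e * L) * \<beta> (Suc n)"
      using an \<beta> e L by (intro add_mono mult_left_mono) auto
    also have "\<dots> = (a n + e * L) * \<beta> (Suc n)" by (simp add: distrib_right)
    also have "\<dots> \<le> L * \<beta> (Suc n)" using aL \<beta> an by (intro mult_right_mono) auto
    finally show ?thesis using var_const_nonneg[OF b1(2) b2(2), of uL] by (auto intro!: mult_left_mono)
  qed
  finally show ?case using step(1) unfolding eq \<beta>_def L_def by (simp add: mult_ac)
qed


text \<open>
  Chernoff bound with exponent \<open>\<theta> = c \<delta> / \<beta>\<close>. The first condition on \<open>c\<close> makes \<open>\<theta>\<close> admissible for the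
  moment generating function, the second makes the quadratic term at most half of the linear gain. The dimension comes
  from a union bound over the coordinates and the two signs.
\<close>
lemma damped_noise_tail:
  fixes N :: "real^'n \<Rightarrow> real"
  assumes lam: "0 < lam" and K: "1 \<le> K" and a0: "a0 \<le> 1"
    and nN: "\<And>x. norm x \<le> N x" and NK: "\<And>x. N x \<le> K * norm x"
    and NA: "\<And>t x. 0 \<le> t \<Longrightarrow> t \<le> a0 \<Longrightarrow> N (x + t *\<^sub>R (A *v x)) \<le> exp (- lam * t) * N x"
    and a: "\<And>n. 0 < a n" "\<And>n. a n \<le> a0"
    and c: "0 < c" "c * \<delta> * K \<le> b2 / 4" "c * (vc * K\<^sup>2 * ((1 + lam) / lam)) \<le> 1 / 2"
    and \<delta>: "0 < \<delta>" and n: "0 < n"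
  shows "prob {\<omega> \<in> space P. real CARD('n) * \<delta> < norm (Y A n \<omega>)}
    \<le> 2 * real CARD('n) * exp (- (c * \<delta>\<^sup>2 / (2 * beta lam a n)))"
proof -
  define \<beta> where "\<beta> = beta lam a n"
  obtain k where k: "n = Suc k" using n by (cases n) auto
  have \<beta>: "0 < \<beta>" using order_less_le_trans[OF a(1)[of k] beta_Suc_ge(1)[where a=a and n=k and lam=lam, OF a(1)]] by (simp add: \<beta>_def k)
  define \<theta> where "\<theta> = c * \<delta> / \<beta>"
  have \<theta>: "0 < \<theta>" using c \<delta> \<beta> by (simp add: \<theta>_def)
  have one: "prob {\<omega> \<in> space P. \<delta> \<le> s * (Y A n \<omega> $ i)} \<le> exp (- (c * \<delta>\<^sup>2 / (2 * \<beta>)))"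
    if s: "\<bar>s\<bar> = 1" for s i
  proof -
    define f where "f x = \<theta> * (s * (x $ i))" for x :: "real^'n"
    have lf: "linear f" unfolding f_def by (rule linearI) (simp_all add: algebra_simps)
    have fb: "\<bar>f x\<bar> \<le> \<theta> * N x" for x
    proof -
      have "\<bar>f x\<bar> = \<theta> * \<bar>x $ i\<bar>" using s \<theta> by (simp add: f_def abs_mult)
      also have "\<dots> \<le> \<theta> * N x"
        using order_trans[OF component_le_norm_cart nN] \<theta> by (intro mult_left_mono) auto
      finally show ?thesis .
    qed
    have "\<theta> * K * beta lam a n \<le> b2 / 4" using c(2) \<beta> by (simp add: \<theta>_def \<beta>_def[symmetric] mult_ac)
    then have mgf: "integrable P (\<lambda>\<omega>. exp (f (Y A n \<omega>)))"
      "(\<integral>\<omega>. exp (f (Y A n \<omega>)) \<partial>P) \<le> exp (vc * (\<theta> * K)\<^sup>2 * ((1 + lam) / lam) * \<beta>)"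
      using damped_noise_mgf[OF lam K a0 NK NA a lf fb] \<theta> by (auto simp: \<beta>_def)
    have "prob {\<omega> \<in> space P. \<delta> \<le> s * (Y A n \<omega> $ i)}
        \<le> exp (- \<theta> * \<delta>) * (\<integral>\<omega>\<in>space P. exp (\<theta> * (s * (Y A n \<omega> $ i))) \<partial>P)"
    proof (rule Chernoff_ineq_ge[OF \<theta>])
      show "set_integrable P (space P) (\<lambda>\<omega>. exp (\<theta> * (s * (Y A n \<omega> $ i))))"
        unfolding set_integrable_def using integrable_mult_indicator[OF sets.top mgf(1)] by (simp add: f_def)
    qed simp
    also have "(\<integral>\<omega>\<in>space P. exp (\<theta> * (s * (Y A n \<omega> $ i))) \<partial>P) = (\<integral>\<omega>. exp (f (Y A n \<omega>)) \<partial>P)"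
      using set_integral_space[OF mgf(1)] by (simp add: f_def)
    also have "exp (- \<theta> * \<delta>) * \<dots> \<le> exp (- \<theta> * \<delta>) * exp (vc * (\<theta> * K)\<^sup>2 * ((1 + lam) / lam) * \<beta>)"
      using mgf(2) by (intro mult_left_mono) auto
    also have "\<dots> = exp (- (c * \<delta>\<^sup>2 / \<beta>) + c * (vc * K\<^sup>2 * ((1 + lam) / lam)) * (c * \<delta>\<^sup>2 / \<beta>))"
    proof -
      have "- \<theta> * \<delta> = - (c * \<delta>\<^sup>2 / \<beta>)" by (simp add: \<theta>_def power2_eq_square)
      moreover have "vc * (\<theta> * K)\<^sup>2 * ((1 + lam) / lam) * \<beta>
          = c * (vc * K\<^sup>2 * ((1 + lam) / lam)) * (c * \<delta>\<^sup>2 / \<beta>)"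
      proof -
        have "vc * (\<theta> * K)\<^sup>2 * ((1 + lam) / lam) * \<beta> = (vc * K\<^sup>2 * ((1 + lam) / lam)) * (\<theta>\<^sup>2 * \<beta>)"
          by (simp only: power_mult_distrib mult_ac)
        also have "\<theta>\<^sup>2 * \<beta> = c * (c * \<delta>\<^sup>2 / \<beta>)"
          using \<beta> by (simp add: \<theta>_def power2_eq_square)
        finally show ?thesis by (simp only: mult_ac)
      qed
      ultimately show ?thesis unfolding exp_add[symmetric] by (simp only:)
    qed
    also have "\<dots> \<le> exp (- (c * \<delta>\<^sup>2 / \<beta>) + 1 / 2 * (c * \<delta>\<^sup>2 / \<beta>))"
      unfolding exp_le_cancel_iff using c \<beta> by (intro add_left_mono mult_right_mono) auto
    also have "\<dots> = exp (- (c * \<delta>\<^sup>2 / (2 * \<beta>)))" by (simp add: field_simps)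
    finally show ?thesis .
  qed
  define E where "E s i = {\<omega> \<in> space P. \<delta> \<le> s * (Y A n \<omega> $ i)}" for s i
  have E [measurable]: "E s i \<in> sets P" for s i unfolding E_def by measurable
  have "{\<omega> \<in> space P. real CARD('n) * \<delta> < norm (Y A n \<omega>)} \<subseteq> (\<Union>i\<in>UNIV. E 1 i \<union> E (- 1) i)"
  proof
    fix \<omega> assume \<omega>: "\<omega> \<in> {\<omega> \<in> space P. real CARD('n) * \<delta> < norm (Y A n \<omega>)}"
    have "\<exists>i. \<delta> < \<bar>Y A n \<omega> $ i\<bar>"
    proof (rule ccontr)
      assume "\<nexists>i. \<delta> < \<bar>Y A n \<omega> $ i\<bar>"
      then have "(\<Sum>i\<in>UNIV. \<bar>Y A n \<omega> $ i\<bar>) \<le> (\<Sum>i\<in>(UNIV :: 'n set). \<delta>)"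
        by (intro sum_mono) (auto simp: not_less)
      then show False using \<omega> norm_le_l1_cart[of "Y A n \<omega>"] by simp
    qed
    then obtain i where i: "\<delta> < \<bar>Y A n \<omega> $ i\<bar>" ..
    then have "\<delta> \<le> 1 * (Y A n \<omega> $ i) \<or> \<delta> \<le> - 1 * (Y A n \<omega> $ i)" by linarith
    then have "\<omega> \<in> E 1 i \<union> E (- 1) i" using \<omega> by (simp add: E_def)
    then show "\<omega> \<in> (\<Union>i\<in>UNIV. E 1 i \<union> E (- 1) i)" by blast
  qed
  then have "prob {\<omega> \<in> space P. real CARD('n) * \<delta> < norm (Y A n \<omega>)} \<le> prob (\<Union>i\<in>UNIV. E 1 i \<union> E (- 1) i)"
    by (intro finite_measure_mono) auto
  also have "\<dots> \<le> (\<Sum>i\<in>UNIV. prob (E 1 i \<union> E (- 1) i))"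
    by (intro finite_measure_subadditive_finite) auto
  also have "\<dots> \<le> (\<Sum>i\<in>(UNIV :: 'n set). 2 * exp (- (c * \<delta>\<^sup>2 / (2 * \<beta>))))"
  proof (rule sum_mono)
    fix i
    have "prob (E 1 i \<union> E (- 1) i) \<le> prob (E 1 i) + prob (E (- 1) i)"
      by (intro measure_Un_le) auto
    then show "prob (E 1 i \<union> E (- 1) i) \<le> 2 * exp (- (c * \<delta>\<^sup>2 / (2 * \<beta>)))"
      using one[of 1 i] one[of "- 1" i] by (simp add: E_def)
  qed
  finally show ?thesis by (simp add: \<beta>_def mult_ac)
qed

end

section \<open>Piecewise linear interpolation\<close>

lemma time_grid_Suc: "time_grid a (Suc n) = time_grid a n + a n"
  by (simp add: time_grid_def)

lemma interpolation_segment: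
  assumes a: "\<And>n. 0 < a n" and n: "time_grid a n \<le> t" "t < time_grid a (Suc n)"
  shows "interpolation a x t = x n + ((t - time_grid a n) / a n) *\<^sub>R (x (Suc n) - x n)"
proof -
  have mono: "time_grid a m \<le> time_grid a k" if "m \<le> k" for m k
    by (rule lift_Suc_mono_le[OF _ that]) (simp add: time_grid_Suc less_imp_le[OF a])
  have "(LEAST n. t < time_grid a (Suc n)) = n"
  proof (rule Least_equality)
    fix m assume "t < time_grid a (Suc m)"
    then show "n \<le> m" using mono[of "Suc m" n] n(1) by (metis not_less_eq_eq order_trans not_less)
  qed (rule n(2))
  then show ?thesis by (simp add: interpolation_def)
qed

lemma time_grid_cover:
  assumes a: "step_sizes a" and t: "0 \<le> t"
  obtains n where "time_grid a n \<le> t" "t < time_grid a (Suc n)"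
proof -
  have "\<exists>n. t < time_grid a n"
    using a unfolding step_sizes_def filterlim_at_top_dense time_grid_def eventually_sequentially by blast
  define m where "m = (LEAST n. t < time_grid a n)"
  have m: "t < time_grid a m" unfolding m_def by (rule LeastI_ex) fact
  have "m \<noteq> 0" using m t by (intro notI) (simp add: time_grid_def)
  then obtain n where n: "m = Suc n" by (cases m) auto
  have "\<not> t < time_grid a n" using not_less_Least[of n "\<lambda>n. t < time_grid a n"] n by (simp add: m_def)
  then show ?thesis using m n by (intro that[of n]) auto
qed

lemma interpolation_in_convex:
  assumes a: "\<And>n. 0 < a n" and C: "convex C"
    and n: "time_grid a n \<le> t" "t < time_grid a (Suc n)" and x: "x n \<in> C" "x (Suc n) \<in> C"
  shows "interpolation a x t \<in> C"
proof -
  define s where "s = (t - time_grid a n) / a n"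
  have s: "0 \<le> s" "s \<le> 1" using a[of n] n by (auto simp: s_def time_grid_Suc field_simps)
  have "interpolation a x t = (1 - s) *\<^sub>R x n + s *\<^sub>R x (Suc n)"
    unfolding interpolation_segment[OF a n] s_def[symmetric] by (simp add: algebra_simps)
  then show ?thesis using convexD_alt[OF C x s] by simp
qed


text \<open>
  Along each linear piece it suffices to look at the end points, where a piece that contains \<open>t0\<close>
  is cut there. This expresses the event of the theorem by countably many conditions, and so shows
  that it is measurable.
\<close>
lemma late_interpolation_iff:
  fixes x :: "nat \<Rightarrow> 'a::real_normed_vector"
  assumes a: "step_sizes a" and t0: "0 \<le> t0"
  shows "(\<forall>t\<ge>t0. norm (interpolation a x t - y) \<le> \<epsilon>) \<longleftrightarrow>
    (\<forall>n. t0 < time_grid a (Suc n) \<longrightarrow>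
       norm (interpolation a x (max t0 (time_grid a n)) - y) \<le> \<epsilon> \<and> norm (x (Suc n) - y) \<le> \<epsilon>)"
    (is "?L \<longleftrightarrow> ?R")
proof
  have a0: "\<And>n. 0 < a n" using a by (simp add: step_sizes_def)
  have grid: "interpolation a x (time_grid a n) = x n" for n
    using interpolation_segment[of a n "time_grid a n" x] a0 by (simp add: time_grid_Suc)
  show ?R if ?L
  proof (intro allI impI)
    fix n assume "t0 < time_grid a (Suc n)"
    then have "norm (interpolation a x (time_grid a (Suc n)) - y) \<le> \<epsilon>" using that by simp
    then show "norm (interpolation a x (max t0 (time_grid a n)) - y) \<le> \<epsilon> \<and> norm (x (Suc n) - y) \<le> \<epsilon>"
      using that by (simp add: grid)
  qed
  show ?L if R: ?R
  proof (intro allI impI)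
    fix t assume t: "t0 \<le> t"
    then obtain n where n: "time_grid a n \<le> t" "t < time_grid a (Suc n)"
      using time_grid_cover[OF a, of t] t0 by auto
    define s where "s = max t0 (time_grid a n)"
    have s: "time_grid a n \<le> s" "s \<le> t" "s < time_grid a (Suc n)" using n t by (auto simp: s_def)
    define \<alpha> where "\<alpha> = (s - time_grid a n) / a n"
    define \<tau> where "\<tau> = (t - time_grid a n) / a n"
    have \<alpha>: "\<alpha> \<le> \<tau>" "\<alpha> < 1" "\<tau> \<le> 1" using s n a0[of n] by (auto simp: \<alpha>_def \<tau>_def divide_simps time_grid_Suc)
    define u where "u = (\<tau> - \<alpha>) / (1 - \<alpha>)"
    have u: "0 \<le> u" "u \<le> 1" using \<alpha> by (auto simp: u_def)
    have \<tau>: "\<tau> = (1 - u) * \<alpha> + u"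
    proof -
      have "u * (1 - \<alpha>) = \<tau> - \<alpha>" using \<alpha> by (simp add: u_def)
      then show ?thesis by (simp add: algebra_simps)
    qed
    have "interpolation a x t = x n + \<tau> *\<^sub>R (x (Suc n) - x n)"
      unfolding \<tau>_def by (rule interpolation_segment[OF a0 n])
    also have "\<dots> = (1 - u) *\<^sub>R (x n + \<alpha> *\<^sub>R (x (Suc n) - x n)) + u *\<^sub>R x (Suc n)"
      unfolding \<tau> by (simp add: algebra_simps)
    also have "x n + \<alpha> *\<^sub>R (x (Suc n) - x n) = interpolation a x s"
      unfolding \<alpha>_def by (rule interpolation_segment[OF a0 s(1,3), symmetric])
    finally have eq: "interpolation a x t = (1 - u) *\<^sub>R interpolation a x s + u *\<^sub>R x (Suc n)" .
    have "t0 < time_grid a (Suc n)" using t n by simp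
    with R have "interpolation a x s \<in> cball y \<epsilon>" "x (Suc n) \<in> cball y \<epsilon>"
      by (auto simp: s_def dist_norm norm_minus_commute)
    from convexD_alt[OF convex_cball this u] show "norm (interpolation a x t - y) \<le> \<epsilon>"
      by (simp add: eq dist_norm norm_minus_commute)
  qed
qed

lemma late_interpolation_sets:
  fixes X :: "nat \<Rightarrow> 'w \<Rightarrow> 'a::euclidean_space"
  assumes a: "step_sizes a" and t0: "0 \<le> t0" and X: "\<And>n. X n \<in> borel_measurable P"
  shows "{\<omega> \<in> space P. \<forall>t\<ge>t0. norm (interpolation a (\<lambda>n. X n \<omega>) t - y) \<le> \<epsilon>} \<in> sets P"
proof -
  have a0: "\<And>n. 0 < a n" using a by (simp add: step_sizes_def)
  note X[measurable]
  have m: "(\<lambda>\<omega>. interpolation a (\<lambda>n. X n \<omega>) (max t0 (time_grid a n))) \<in> borel_measurable P"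
    if "t0 < time_grid a (Suc n)" for n
  proof -
    have "max t0 (time_grid a n) < time_grid a (Suc n)" using that a0[of n] by (simp add: time_grid_Suc)
    then have "interpolation a (\<lambda>n. X n \<omega>) (max t0 (time_grid a n)) = X n \<omega> +
        ((max t0 (time_grid a n) - time_grid a n) / a n) *\<^sub>R (X (Suc n) \<omega> - X n \<omega>)" for \<omega>
      by (intro interpolation_segment a0) auto
    then show ?thesis by simp
  qed
  have "{\<omega> \<in> space P. t0 < time_grid a (Suc n) \<longrightarrow>
       norm (interpolation a (\<lambda>n. X n \<omega>) (max t0 (time_grid a n)) - y) \<le> \<epsilon> \<and> norm (X (Suc n) \<omega> - y) \<le> \<epsilon>} \<in> sets P" for n
  proof (cases "t0 < time_grid a (Suc n)")
    case True
    note m[OF True, measurable]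
    show ?thesis by measurable
  qed simp
  then show ?thesis
    unfolding late_interpolation_iff[OF a t0] by (rule sets.sets_Collect_countable_All)
qed

section \<open>The concentration bound\<close>

theorem corollary1p1:
  fixes h :: "real^'n \<Rightarrow> real^'n" and xs :: "real^'n"
    and D :: "(real^'n) set" and V :: "real^'n \<Rightarrow> real"
    and c1 c2 :: "real^'n \<Rightarrow> real" and uL r lam :: real
  assumes "twice_cont_differentiable h"
    and "locally_asymptotically_stable h xs"
    and "hurwitz (jacobian h (at xs))"
    and "admissible_rate (jacobian h (at xs)) lam"
    and "liapunov_function h xs D V"
    and "r > 0" and "compact (sublevel D V r)"
    and "continuous_on UNIV c1" and "\<And>x. c1 x > 0"
    and "continuous_on UNIV c2" and "\<And>x. c2 x > 0"
  shows "\<exists>C1 C2 :: real. \<exists>g1 g2 :: real \<Rightarrow> real.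
    C1 > 0 \<and> C2 > 0 \<and>
    g1 \<in> O[at_right 0](\<lambda>\<epsilon>. ln (1 / \<epsilon>)) \<and> g2 \<in> O[at_right 0](\<lambda>\<epsilon>. 1 / \<epsilon>) \<and>
    (\<forall>(r0 :: real) (\<epsilon>0 :: real) (B :: (real^'n) set) (\<epsilon> :: real) (T :: real) (a :: nat \<Rightarrow> real)
       (P :: 'w measure) (x0 :: 'w \<Rightarrow> real^'n) (M :: nat \<Rightarrow> 'w \<Rightarrow> real^'n).
       bounded B \<and> xs \<in> B \<and> (\<exists>A. attraction_domain h xs A \<and> B \<subseteq> A) \<and>
       0 < r0 \<and> r0 < r \<and> 0 < \<epsilon>0 \<and>
       (\<forall>e. 0 < e \<and> e \<le> \<epsilon>0 \<longrightarrow> {x. norm (x - xs) \<le> e} \<subseteq> B) \<and>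
       B \<subseteq> sublevel D V r0 \<and>
       sublevel D V r0 \<subset> nbhd \<epsilon>0 (sublevel D V r0) \<and>
       nbhd \<epsilon>0 (sublevel D V r0) \<subseteq> sublevel D V r \<and>
       sublevel D V r \<subset> D \<and>
       step_sizes a \<and>
       prob_space P \<and> x0 \<in> borel_measurable P \<and>
       martingale_difference P x0 M \<and> exponential_tails P h a x0 M c1 c2 uL \<and>
       0 < \<epsilon> \<and> \<epsilon> \<le> \<epsilon>0 \<and>
       T \<ge> g1 \<epsilon> \<and> (\<forall>n. 1 / a n \<ge> g2 \<epsilon>) \<and>
       (AE \<omega> in P. x0 \<omega> \<in> B)
       \<longrightarrow>
       ereal (measure P {\<omega> \<in> space P. \<forall>t\<ge>T + 1.
                norm (interpolation a (\<lambda>n. iterate h a x0 M n \<omega>) t - xs) \<le> \<epsilon>})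
       \<ge> 1 - (\<Sum>n. ereal (C1 * exp (- (C2 * sqrt \<epsilon> / sqrt (a n)))))
           - (\<Sum>n. ereal (if n = 0 then 0
                           else C1 * exp (- (C2 * min \<epsilon> (\<epsilon>\<^sup>2) / beta lam a n)))))"
proof -
  define A where "A = jacobian h (at xs)"
  define S where "S = sublevel D V r"
  have hc: "continuous_on UNIV h"
  proof -
    have "\<exists>Dh :: real^'n \<Rightarrow> (real^'n) \<Rightarrow>\<^sub>L (real^'n). \<forall>x. (h has_derivative blinfun_apply (Dh x)) (at x)"
      using assms(1) unfolding twice_cont_differentiable_def by blast
    then have "isCont h x" for x
      using has_derivative_continuous by blast
    then show ?thesis by (simp add: continuous_at_imp_continuous_on)
  qed
  have "h differentiable (at xs)"
    using assms(1) unfolding twice_cont_differentiable_def differentiable_def by blast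
  then have hd: "(h has_derivative (\<lambda>v. A *v v)) (at xs)"
    unfolding A_def jacobian_works .
  have h0: "h xs = 0" using assms(2) by (simp add: locally_asymptotically_stable_def)
  obtain N K a1 where lam: "0 < lam" and K: "1 \<le> K" and a1: "0 < a1"
    and Nadd: "\<And>x y. N (x + y) \<le> N x + N y"
    and nN: "\<And>x. norm x \<le> N x" and NK: "\<And>x. N x \<le> K * norm x"
    and NA: "\<And>a x. 0 \<le> a \<Longrightarrow> a \<le> a1 \<Longrightarrow> N (x + a *\<^sub>R (A *v x)) \<le> exp (- lam * a) * N x"
    by (rule adapted_norm_exists[OF assms(4)[folded A_def]]) (rule that)
  obtain \<rho> \<sigma> T1 where \<rho>: "0 < \<rho>" "\<rho> \<le> 1/2" and \<sigma>: "0 < \<sigma>" and T1: "0 \<le> T1"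
    and trap: "euler_trapping h A D V xs r lam \<rho> \<sigma> T1"
    by (rule perturbed_euler_trapped[OF lam K a1 Nadd nN NK _ hd h0 hc assms(5,6,7)]) (rule NA, assumption, assumption, rule that)
  have S: "compact S" "xs \<in> S" "S \<in> sets borel"
    using assms(5,6,7) by (auto simp: S_def sublevel_def liapunov_function_def intro: borel_compact)
  obtain b1 where b1: "\<And>x. x \<in> S \<Longrightarrow> c1 x \<le> b1" "0 \<le> b1"
  proof -
    obtain y where "\<And>x. x \<in> S \<Longrightarrow> c1 x \<le> c1 y"
      using continuous_attains_sup[OF S(1) _ continuous_on_subset[OF assms(8)]] S(2) by blast
    then show ?thesis using assms(9)[of y] by (intro that[of "c1 y"]) auto
  qed
  obtain b2 where b2: "\<And>x. x \<in> S \<Longrightarrow> b2 \<le> c2 x" "0 < b2"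
  proof -
    obtain y where "\<And>x. x \<in> S \<Longrightarrow> c2 y \<le> c2 x"
      using continuous_attains_inf[OF S(1) _ continuous_on_subset[OF assms(10)]] S(2) by blast
    then show ?thesis using assms(11)[of y] by (intro that[of "c2 y"]) auto
  qed
  obtain R where R: "0 < R" "\<And>x. x \<in> S \<Longrightarrow> norm (x - xs) \<le> R"
  proof -
    have "bounded ((\<lambda>x. x - xs) ` S)"
      using compact_imp_bounded[OF S(1)] by (rule bounded_translation_minus)
    then show ?thesis using that unfolding bounded_pos by blast
  qed
  define d where "d = real CARD('n)"
  have d: "1 \<le> d" by (simp add: d_def Suc_le_eq)
  \<comment> \<open>The level \<open>\<delta> = \<kappa> \<epsilon>\<close> must be below \<open>\<rho>\<close> and \<open>\<sigma>\<close> for every \<open>\<epsilon> \<le> R\<close>, and \<open>2 \<delta> \<le> \<epsilon> / 2\<close>.\<close>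
  define \<kappa> where "\<kappa> = min (1 / 4) (min (\<rho> / R) (\<sigma> / R))"
  have \<kappa>: "0 < \<kappa>" "\<kappa> \<le> 1 / 4" "\<kappa> * R \<le> \<rho>" "\<kappa> * R \<le> \<sigma>"
    using \<rho> \<sigma> R by (auto simp: \<kappa>_def min_def field_simps)
  define v where "v = var_const b1 b2 uL * K\<^sup>2 * ((1 + lam) / lam)"
  have v: "0 \<le> v" using var_const_nonneg[OF b1(2) b2(2), of uL] lam by (simp add: v_def)
  \<comment> \<open>The two bounds are the conditions on \<open>c\<close> in the tail estimate, for all \<open>\<delta> \<le> R\<close>.\<close>
  define c where "c = min (b2 / (4 * R * K)) (1 / (2 * (v + 1)))"
  have c0: "0 < c" using b2 R K v by (simp add: c_def)
  have cR: "c * R * K \<le> b2 / 4"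
  proof -
    have "c * (R * K) \<le> b2 / (4 * R * K) * (R * K)"
      using R K by (intro mult_right_mono) (auto simp: c_def)
    then show ?thesis using R K by (simp add: mult.assoc)
  qed
  have cv: "c * v \<le> 1 / 2"
  proof -
    have "c * v \<le> 1 / (2 * (v + 1)) * v" using v by (intro mult_right_mono) (auto simp: c_def)
    also have "\<dots> \<le> 1 / 2" using v by (simp add: field_simps)
    finally show ?thesis .
  qed
  define a0 where "a0 = min (min a1 \<sigma>) 1"
  have a0: "0 < a0" "a0 \<le> a1" "a0 \<le> \<sigma>" "a0 \<le> 1" using a1 \<sigma> by (auto simp: a0_def)
  define C1 where "C1 = 2 * d"
  define C2 where "C2 = c * \<kappa>\<^sup>2 / (2 * d\<^sup>2)"
  define g1 where "g1 \<epsilon> = T1 + 4 / lam * \<bar>ln \<epsilon>\<bar> + 1" for \<epsilon> :: real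
  define g2 where "g2 \<epsilon> = 1 / a0" for \<epsilon> :: real
  have C: "0 < C1" "0 < C2" using d c0 \<kappa> by (auto simp: C1_def C2_def)
  have g1: "g1 \<in> O[at_right 0](\<lambda>\<epsilon>. ln (1 / \<epsilon>))"
  proof (rule bigoI)
    have "\<forall>\<^sub>F \<epsilon> in at_right (0::real). 0 < \<epsilon> \<and> \<epsilon> < exp (- 1)"
      unfolding eventually_at_right_field by (intro exI[of _ "exp (- 1)"]) auto
    then show "\<forall>\<^sub>F \<epsilon> in at_right 0. norm (g1 \<epsilon>) \<le> (T1 + 4 / lam + 1) * norm (ln (1 / \<epsilon>))"
    proof eventually_elim
      case (elim \<epsilon>)
      have "ln \<epsilon> \<le> - 1" using elim by (metis less_eq_real_def ln_exp ln_less_cancel_iff exp_gt_zero)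
      then have l: "1 \<le> \<bar>ln \<epsilon>\<bar>" by simp
      have "T1 * 1 \<le> T1 * \<bar>ln \<epsilon>\<bar>" using T1 l by (intro mult_left_mono)
      then have "g1 \<epsilon> \<le> (T1 + 4 / lam + 1) * \<bar>ln \<epsilon>\<bar>" using l by (simp add: g1_def distrib_right)
      moreover have "0 \<le> g1 \<epsilon>" using T1 lam by (simp add: g1_def)
      ultimately show ?case using elim by (simp add: ln_div)
    qed
  qed
  have g2: "g2 \<in> O[at_right 0](\<lambda>\<epsilon>. 1 / \<epsilon>)"
  proof (rule bigoI)
    have "\<forall>\<^sub>F \<epsilon> in at_right (0::real). 0 < \<epsilon> \<and> \<epsilon> < 1"
      unfolding eventually_at_right_field by (intro exI[of _ 1]) auto
    then show "\<forall>\<^sub>F \<epsilon> in at_right 0. norm (g2 \<epsilon>) \<le> 1 / a0 * norm (1 / \<epsilon>)"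
    proof eventually_elim
      case (elim \<epsilon>)
      have "1 / a0 * 1 \<le> 1 / a0 * (1 / \<epsilon>)" using elim a0 by (intro mult_left_mono) auto
      then show ?case using elim a0 by (simp add: g2_def)
    qed
  qed
  have main: "ereal (measure P {\<omega> \<in> space P. \<forall>t\<ge>T + 1.
                norm (interpolation a (\<lambda>n. iterate h a x0 M n \<omega>) t - xs) \<le> \<epsilon>})
       \<ge> 1 - (\<Sum>n. ereal (C1 * exp (- (C2 * sqrt \<epsilon> / sqrt (a n)))))
           - (\<Sum>n. ereal (if n = 0 then 0
                           else C1 * exp (- (C2 * min \<epsilon> (\<epsilon>\<^sup>2) / beta lam a n))))"
    if r0: "r0 < r" and ball: "\<And>e. 0 < e \<Longrightarrow> e \<le> \<epsilon>0 \<Longrightarrow> {x. norm (x - xs) \<le> e} \<subseteq> B"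
      and B: "B \<subseteq> sublevel D V r0" and nb: "nbhd \<epsilon>0 (sublevel D V r0) \<subseteq> sublevel D V r"
      and steps: "step_sizes a" and P: "prob_space P" "x0 \<in> borel_measurable P"
      and mart: "martingale_difference P x0 M" and tails: "exponential_tails P h a x0 M c1 c2 uL"
      and \<epsilon>: "0 < \<epsilon>" "\<epsilon> \<le> \<epsilon>0" and T: "g1 \<epsilon> \<le> T" and ag: "\<And>n. g2 \<epsilon> \<le> 1 / a n"
      and x0B: "AE \<omega> in P. x0 \<omega> \<in> B"
    for r0 \<epsilon>0 \<epsilon> T :: real and B :: "(real^'n) set" and a :: "nat \<Rightarrow> real" and P :: "'w measure"
      and x0 :: "'w \<Rightarrow> real^'n" and M :: "nat \<Rightarrow> 'w \<Rightarrow> real^'n"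
  proof -
    interpret prob_space P by (rule P(1))
    interpret tailed_noise P h a x0 M c1 c2 uL b1 b2 S
      by unfold_locales (use hc P(2) mart tails S(3) b1 b2 in auto)
    have ap: "0 < a n" for n using steps by (simp add: step_sizes_def)
    have aa0: "a n \<le> a0" for n
      using ag[of n] ap[of n] a0 by (simp add: g2_def field_simps)
    \<comment> \<open>The ball of radius \<open>\<epsilon>\<close> lies in \<open>S\<close>, and it contains points at distance \<open>\<epsilon>\<close> from the centre.\<close>
    have \<epsilon>R: "\<epsilon> \<le> R"
    proof -
      define y where "y = xs + \<epsilon> *\<^sub>R axis (undefined :: 'n) (1::real)"
      have y: "norm (y - xs) = \<epsilon>" using \<epsilon> by (simp add: y_def)
      then have "y \<in> B" using ball[OF \<epsilon>] by blast
      then have "y \<in> S" using B r0 by (auto simp: S_def sublevel_def)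
      then show ?thesis using R(2)[of y] y by simp
    qed
    define \<delta> where "\<delta> = \<kappa> * \<epsilon>"
    have \<delta>: "0 < \<delta>" "\<delta> \<le> \<epsilon> / 4" "\<delta> \<le> \<rho>" "\<delta> \<le> \<sigma>" "\<delta> \<le> R"
    proof -
      show "0 < \<delta>" using \<kappa> \<epsilon> by (simp add: \<delta>_def)
      show 4: "\<delta> \<le> \<epsilon> / 4" using mult_right_mono[OF \<kappa>(2), of \<epsilon>] \<epsilon> by (simp add: \<delta>_def)
      have "\<delta> \<le> \<kappa> * R" using \<epsilon>R \<kappa> by (simp add: \<delta>_def)
      then show "\<delta> \<le> \<rho>" "\<delta> \<le> \<sigma>" using \<kappa> by auto
      show "\<delta> \<le> R" using 4 \<epsilon> \<epsilon>R by linarith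
    qed
    define G where "G = {\<omega> \<in> space P. \<forall>t\<ge>T + 1. norm (interpolation a (\<lambda>n. X n \<omega>) t - xs) \<le> \<epsilon>}"
    define Bad where "Bad n = {\<omega> \<in> space P. \<delta> < norm (Y A n \<omega>)}" for n
    define p where "p n = (if n = 0 then 0 else C1 * exp (- (C2 * min \<epsilon> (\<epsilon>\<^sup>2) / beta lam a n)))" for n
    have p0: "0 \<le> p n" for n using C by (simp add: p_def)
    have T0: "0 \<le> T" "T1 + 4 / lam * \<bar>ln \<epsilon>\<bar> < T"
    proof -
      show "T1 + 4 / lam * \<bar>ln \<epsilon>\<bar> < T" using T by (simp add: g1_def)
      moreover have "0 \<le> 4 / lam * \<bar>ln \<epsilon>\<bar>" using lam by simp
      ultimately show "0 \<le> T" using T1 by linarith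
    qed
    have G: "G \<in> sets P" unfolding G_def by (rule late_interpolation_sets[OF steps]) (use T0 in auto)
    have Bad: "Bad n \<in> sets P" for n unfolding Bad_def by measurable
    have bad: "prob (Bad n) \<le> p n" for n
    proof (cases "n = 0")
      case True
      then show ?thesis using \<delta>(1) by (simp add: Bad_def p_def)
    next
      case False
      define \<beta> where "\<beta> = beta lam a n"
      have \<beta>: "0 \<le> \<beta>" unfolding \<beta>_def by (rule beta_nonneg) (rule ap)
      have NA': "N (x + t *\<^sub>R (A *v x)) \<le> exp (- lam * t) * N x" if "0 \<le> t" "t \<le> a0" for t x
        using that a0 by (intro NA) auto
      have "c * (\<delta> / d) * K \<le> c * R * K"
      proof -
        have "\<delta> / d \<le> \<delta>" using \<delta> d by (simp add: field_simps)
        then show ?thesis using \<delta> c0 K by (intro mult_right_mono mult_left_mono) auto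
      qed
      then have c2: "c * (\<delta> / d) * K \<le> b2 / 4" using cR by linarith
      have "prob {\<omega> \<in> space P. real CARD('n) * (\<delta> / d) < norm (Y A n \<omega>)}
          \<le> 2 * real CARD('n) * exp (- (c * (\<delta> / d)\<^sup>2 / (2 * beta lam a n)))"
        by (rule damped_noise_tail[OF lam K a0(4) nN NK _ ap aa0 c0 c2 cv[unfolded v_def]])
           (use \<delta> d False NA' in auto)
      also have "{\<omega> \<in> space P. real CARD('n) * (\<delta> / d) < norm (Y A n \<omega>)} = Bad n"
        by (simp add: Bad_def d_def)
      also have "c * (\<delta> / d)\<^sup>2 / (2 * beta lam a n) = C2 * \<epsilon>\<^sup>2 / \<beta>"
        by (simp add: \<delta>_def C2_def \<beta>_def power_mult_distrib power_divide)
      also have "2 * real CARD('n) * exp (- (C2 * \<epsilon>\<^sup>2 / \<beta>)) \<le> C1 * exp (- (C2 * min \<epsilon> (\<epsilon>\<^sup>2) / \<beta>))"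
      proof -
        have "C2 * min \<epsilon> (\<epsilon>\<^sup>2) / \<beta> \<le> C2 * \<epsilon>\<^sup>2 / \<beta>"
          using C \<beta> by (intro divide_right_mono mult_left_mono) auto
        then show ?thesis using C by (simp add: C1_def d_def)
      qed
      finally show ?thesis using False by (simp add: p_def \<beta>_def)
    qed
    have path: "\<omega> \<in> G" if \<omega>: "\<omega> \<in> space P" and x0: "x0 \<omega> \<in> B" and good: "\<And>n. \<omega> \<notin> Bad n" for \<omega>
    proof -
      have Yb: "norm (Y A n \<omega>) \<le> \<delta>" for n using good[of n] \<omega> by (simp add: Bad_def not_less)
      have conv: "norm (X n \<omega> - xs) \<le> 2 * \<delta> + \<rho> * exp (- (lam / 4) * (time_grid a n - T1))"
        if "T1 < time_grid a n" for n
      proof -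
        have "\<delta> \<le> \<epsilon>0" using \<delta> \<epsilon> by linarith
        then have "nbhd \<delta> (sublevel D V r0) \<subseteq> nbhd \<epsilon>0 (sublevel D V r0)"
          unfolding nbhd_def by (auto intro: order_trans)
        then have 1: "nbhd \<delta> (sublevel D V r0) \<subseteq> sublevel D V r" using nb by blast
        have 2: "0 < a n \<and> a n \<le> \<sigma>" for n using ap[of n] aa0[of n] a0 by linarith
        have 3: "X 0 \<omega> - Y A 0 \<omega> \<in> sublevel D V r0" using x0 B by auto
        have 4: "X (Suc n) \<omega> - Y A (Suc n) \<omega> = (X n \<omega> - Y A n \<omega>) + a n *\<^sub>R (h (X n \<omega>) - A *v Y A n \<omega>)"
          if "X n \<omega> \<in> sublevel D V r" for n
          using that by (simp add: S_def algebra_simps)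
        have "\<forall>n. T1 < time_grid a n \<longrightarrow>
          norm (X n \<omega> - xs) \<le> 2 * \<delta> + \<rho> * exp (- (lam / 4) * (time_grid a n - T1))"
        proof (rule trap[unfolded euler_trapping_def, THEN spec[of _ r0], THEN spec[of _ \<delta>], THEN spec[of _ a],
              THEN spec[of _ "\<lambda>n. X n \<omega>"], THEN spec[of _ "\<lambda>n. Y A n \<omega>"], THEN mp], intro conjI allI impI)
          show "r0 \<le> r" using r0 by simp
        qed (use \<delta>(3,4) Yb 1 2 3 4 in blast)+
        then show ?thesis using that by blast
      qed
      \<comment> \<open>After time \<open>T\<close> the exponential term has decayed to \<open>\<epsilon> / 2\<close>, because \<open>\<rho> \<le> 1 / 2\<close>.\<close>
      have late: "X n \<omega> \<in> cball xs \<epsilon>" if "T < time_grid a n" for n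
      proof -
        have l: "4 / lam * \<bar>ln \<epsilon>\<bar> \<le> time_grid a n - T1" using that T0 by linarith
        have "0 \<le> 4 / lam * \<bar>ln \<epsilon>\<bar>" using lam by simp
        then have "T1 < time_grid a n" using that T0 by linarith
        note conv[OF this]
        also have "exp (- (lam / 4) * (time_grid a n - T1)) \<le> exp (ln \<epsilon>)"
        proof -
          have "lam / 4 * (4 / lam * \<bar>ln \<epsilon>\<bar>) \<le> lam / 4 * (time_grid a n - T1)"
            using l lam by (intro mult_left_mono) auto
          then have "\<bar>ln \<epsilon>\<bar> \<le> lam / 4 * (time_grid a n - T1)" using lam by simp
          then show ?thesis by simp
        qed
        then have "\<rho> * exp (- (lam / 4) * (time_grid a n - T1)) \<le> 1 / 2 * \<epsilon>"
          using \<rho> \<epsilon> by (intro mult_mono) auto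
        finally show ?thesis using \<delta> by (simp add: dist_norm norm_minus_commute)
      qed
      have "norm (interpolation a (\<lambda>n. X n \<omega>) t - xs) \<le> \<epsilon>" if t: "T + 1 \<le> t" for t
      proof -
        have "0 \<le> t" using t T0 by linarith
        from time_grid_cover[OF steps this] obtain n where n: "time_grid a n \<le> t" "t < time_grid a (Suc n)" .
        \<comment> \<open>Steps have length at most \<open>1\<close>, so the piece that contains \<open>t\<close> starts after \<open>T\<close>.\<close>
        have "a n \<le> 1" using aa0[of n] a0 by linarith
        then have "T < time_grid a n" "T < time_grid a (Suc n)"
          using n t by (auto simp: time_grid_Suc)
        then have "interpolation a (\<lambda>n. X n \<omega>) t \<in> cball xs \<epsilon>"
          by (intro interpolation_in_convex[where n = n] ap convex_cball n late)
        then show ?thesis by (simp add: dist_norm norm_minus_commute)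
      qed
      then show ?thesis using \<omega> by (simp add: G_def)
    qed
    have "prob (space P - G) \<le> prob (\<Union>n. Bad n)"
    proof (rule finite_measure_mono_AE)
      show "AE \<omega> in P. \<omega> \<in> space P - G \<longrightarrow> \<omega> \<in> (\<Union>n. Bad n)"
        using x0B by eventually_elim (use path in blast)
      show "(\<Union>n. Bad n) \<in> sets P" using Bad by blast
    qed
    then have PG: "1 - prob (\<Union>n. Bad n) \<le> prob G" using prob_compl[OF G] by simp
    define S1 where "S1 = (\<Sum>n. ereal (C1 * exp (- (C2 * sqrt \<epsilon> / sqrt (a n)))))"
    define S2 where "S2 = (\<Sum>n. ereal (p n))"
    have S1: "0 \<le> S1" unfolding S1_def using C by (intro suminf_nonneg summable_ereal_pos) auto
    have "1 - S1 - S2 \<le> ereal (prob G)"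
    proof (cases "S2 = \<infinity>")
      case True
      then show ?thesis using S1 by (cases S1) (auto simp: one_ereal_def)
    next
      case False
      then have sp: "summable p" and S2: "S2 = ereal (suminf p)"
        unfolding S2_def using p0 by (auto intro: summable_ereal suminf_ereal)
      have sb: "summable (\<lambda>n. prob (Bad n))"
        by (rule summable_comparison_test'[OF sp]) (use bad in auto)
      have "prob (\<Union>n. Bad n) \<le> (\<Sum>n. prob (Bad n))"
        using Bad sb by (intro finite_measure_subadditive_countably) auto
      also have "\<dots> \<le> suminf p" by (intro suminf_le bad sb sp)
      finally have "1 - suminf p \<le> prob G" using PG by linarith
      then show ?thesis using S1 unfolding S2 by (cases S1) (auto simp: one_ereal_def)
    qed
    then show ?thesis unfolding S1_def S2_def p_def G_def .
  qed
  show ?thesis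
  proof (rule exI[of _ C1], rule exI[of _ C2], rule exI[of _ g1], rule exI[of _ g2],
      intro conjI C g1 g2 allI impI, goal_cases)
    case (1 r0 \<epsilon>0 B \<epsilon> T a P x0 M)
    show ?case
      by (rule main[where ?r0.0 = r0 and ?\<epsilon>0.0 = \<epsilon>0 and B = B]) (use 1 in blast)+
  qed
qed

end
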